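(* Let $\mathcal{D}$ be the poset of isomorphism types of finite directed graphs ordered by the induced-substructure relation $\sqsubseteq$. Then, as subgroups of $\mathrm{Aut}\,\mathcal{D}_3$, $$\mathrm{Aut}_3\,\mathcal{D} = \mathrm{Aut}_3\,\mathcal{D}_4,$$ and this group is isomorphic to the $768$-element group $\mathcal{C}=(\mathbb{Z}_2^4\times S_4)\rtimes_\alpha \mathbb{Z}_2$, where $S_4$ is the symmetric group on the four-element set $\{A,B,C,D\}$, $\alpha(0)=\mathrm{id}$, and $$\alpha(1):(p,q,r,s,\pi)\mapsto (q,p,s,r,(BC)\,\pi\,(BC))\qquad (p,q,r,s\in\{0,1\},\ \pi\in S_4).$$
   Context: A directed graph (digraph) is a nonempty set $V(G)$ of vertices together with a binary relation on it, the set of edges (loops are allowed; there is at most one edge from $x$ to $y$ for each ordered pair $(x,y)$). $\mathcal{D}$ denotes the set of isomorphism types of finite digraphs. For $G,H\in\mathcal{D}$, $G\sqsubseteq H$ means that $G$ is isomorphic to a spanned (i.e. induced) subgraph of $H$. $(\mathcal{D};\sqsubseteq)$ is a graded poset whose $n$-th level consists of the digraphs with exactly $n$ vertices. For a graded poset $\mathcal{P}$, $\mathcal{P}_n$ denotes the subposet consisting of the first $n$ levels; so $\mathcal{D}_n=\{G\in\mathcal{D}: |V(G)|\le n\}$ with the order $\sqsubseteq$, and the first $n$ levels of $\mathcal{D}_m$ are $\mathcal{D}_n$ for $n\le m$. $\mathrm{Aut}\,\mathcal{P}$ is the group of order automorphisms of $\mathcal{P}$; $\mathcal{P}_n$ is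 invariant under $\mathrm{Aut}\,\mathcal{P}$. For $\varphi\in\mathrm{Aut}\,\mathcal{P}$, $\varphi|_n$ denotes the restriction of $\varphi$ to $\mathcal{P}_n$, and $\mathrm{Aut}_n\,\mathcal{P}=\{\varphi|_n : \varphi\in\mathrm{Aut}\,\mathcal{P}\}$, a subgroup of $\mathrm{Aut}\,\mathcal{P}_n$. Thus $\mathrm{Aut}_3\,\mathcal{D}$ (resp. $\mathrm{Aut}_3\,\mathcal{D}_4$) is the group of restrictions to $\mathcal{D}_3$ of the automorphisms of $\mathcal{D}$ (resp. of $\mathcal{D}_4$). $(BC)$ denotes the transposition exchanging $B$ and $C$; elements of $\mathbb{Z}_2^4\times S_4$ are written $(p,q,r,s,\pi)$; $\alpha:\mathbb{Z}_2\to\mathrm{Aut}(\mathbb{Z}_2^4\times S_4)$. *)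

theory Defs
  imports
    "Graph_Theory.Digraph_Isomorphism"
    "HOL-Algebra.Bij"
    "HOL-Algebra.Coset"
    "HOL-Algebra.Elementary_Groups"
    "HOL-Combinatorics.Transposition"
begin

section \<open>The poset of isomorphism types of finite digraphs\<close>

text \<open>
  Loops are allowed and there are no parallel arcs, so \<^typ>\<open>'a pair_pre_digraph\<close> is the
  appropriate record.  Up to isomorphism the vertices may be taken to be natural numbers.
\<close>

definition fin_digraphs :: "nat pair_pre_digraph set" where
  "fin_digraphs = {G. pair_fin_digraph G \<and> pverts G \<noteq> {}}"

definition digraph_iso_rel :: "nat pair_pre_digraph rel" where
  "digraph_iso_rel =
     {(G, H) \<in> fin_digraphs \<times> fin_digraphs. digraph_iso (with_proj G) (with_proj H)}"

type_synonym iso_type = "nat pair_pre_digraph set"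

definition iso_types :: "iso_type set" where
  "iso_types = fin_digraphs // digraph_iso_rel"

definition emb :: "iso_type \<Rightarrow> iso_type \<Rightarrow> bool" (infix \<open>\<sqsubseteq>\<^sub>D\<close> 50) where
  "X \<sqsubseteq>\<^sub>D Y \<longleftrightarrow> (\<exists>G\<in>X. \<exists>H\<in>Y. \<exists>K. induced_subgraph (with_proj K) (with_proj H)
                        \<and> digraph_iso (with_proj G) (with_proj K))"

text \<open>
  The rank of an isomorphism type is its number of vertices, which is the same for all its members.
\<close>

definition first_levels :: "nat \<Rightarrow> iso_type set \<Rightarrow> iso_type set" where
  "first_levels n P = {X \<in> P. \<exists>G\<in>X. card (pverts G) \<le> n}"


section \<open>Automorphisms of posets and their restrictions\<close>

definition order_auts :: "'a set \<Rightarrow> ('a \<Rightarrow> 'a \<Rightarrow> bool) \<Rightarrow> ('a \<Rightarrow> 'a) set" where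
  "order_auts P R = {f \<in> Bij P. \<forall>x\<in>P. \<forall>y\<in>P. R (f x) (f y) \<longleftrightarrow> R x y}"

definition OrderAutGroup :: "'a set \<Rightarrow> ('a \<Rightarrow> 'a \<Rightarrow> bool) \<Rightarrow> ('a \<Rightarrow> 'a) monoid" where
  "OrderAutGroup P R = BijGroup P \<lparr>carrier := order_auts P R\<rparr>"

definition restricted_auts :: "nat \<Rightarrow> iso_type set \<Rightarrow> (iso_type \<Rightarrow> iso_type) set" where
  "restricted_auts n P = (\<lambda>\<phi>. restrict \<phi> (first_levels n P)) ` order_auts P (\<sqsubseteq>\<^sub>D)"


section \<open>The group of order 768\<close>

definition semidirect_product ::
  "('a, 'c) monoid_scheme \<Rightarrow> ('b, 'd) monoid_scheme \<Rightarrow> ('b \<Rightarrow> 'a \<Rightarrow> 'a) \<Rightarrow> ('a \<times> 'b) monoid" where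
  "semidirect_product N K \<theta> =
     \<lparr>carrier = carrier N \<times> carrier K,
      mult = (\<lambda>(x, k) (y, l). (x \<otimes>\<^bsub>N\<^esub> \<theta> k y, k \<otimes>\<^bsub>K\<^esub> l)),
      one = (\<one>\<^bsub>N\<^esub>, \<one>\<^bsub>K\<^esub>)\<rparr>"

datatype letter = LA | LB | LC | LD

type_synonym base_elem = "int \<times> int \<times> int \<times> int \<times> (letter \<Rightarrow> letter)"

text \<open>The factor \<^term>\<open>integer_mod_group 2\<close> has carrier \<^term>\<open>{0, 1 :: int}\<close>.\<close>

definition base_group :: "base_elem monoid" where
  "base_group = integer_mod_group 2 \<times>\<times> integer_mod_group 2 \<times>\<times> integer_mod_group 2
                  \<times>\<times> integer_mod_group 2 \<times>\<times> BijGroup (UNIV :: letter set)"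

text \<open>The restrictions serve to make \<open>alpha k\<close> an element of \<^term>\<open>AutoGroup base_group\<close>.\<close>

definition alpha :: "int \<Rightarrow> base_elem \<Rightarrow> base_elem" where
  "alpha k = (if k = 0 then (\<lambda>x \<in> carrier base_group. x)
     else restrict
       (\<lambda>(p, q, r, s, \<pi>). (q, p, s, r, transpose LB LC \<circ> \<pi> \<circ> transpose LB LC))
       (carrier base_group))"

definition C_group :: "(base_elem \<times> int) monoid" where
  "C_group = semidirect_product base_group (integer_mod_group 2) alpha"


section \<open>Well-definedness\<close>

lemma digraph_iso_with_proj_iff:
  assumes "pair_wf_digraph G"
  shows "digraph_iso (with_proj G) (with_proj H) \<longleftrightarrow>
    (\<exists>f. inj_on f (pverts G) \<and> pverts H = f ` pverts G \<and> parcs H = map_prod f f ` parcs G)"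
    (is "?L \<longleftrightarrow> ?R")
proof
  assume ?L
  then obtain f where f: "pre_digraph.digraph_isomorphism (with_proj G) f"
    and H: "with_proj H = app_iso f (with_proj G)"
    by (auto simp: digraph_iso_def)
  have a: "iso_arcs f e = map_prod (iso_verts f) (iso_verts f) e" if "e \<in> parcs G" for e
  proof -
    have t: "iso_tail f = fst" "iso_head f = snd"
      using H by (auto simp: with_proj_def app_iso_def)
    have "iso_verts f (fst e) = iso_tail f (iso_arcs f e)"
         "iso_verts f (snd e) = iso_head f (iso_arcs f e)"
      using f that by (auto simp: pre_digraph.digraph_isomorphism_def with_proj_def)
    then show ?thesis
      using t by (cases e, cases "iso_arcs f e") auto
  qed
  have "inj_on (iso_verts f) (pverts G)"
    using f by (auto simp: pre_digraph.digraph_isomorphism_def)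
  moreover have "pverts H = iso_verts f ` pverts G" "parcs H = iso_arcs f ` parcs G"
    using H by (auto simp: with_proj_def app_iso_def)
  moreover have "iso_arcs f ` parcs G = map_prod (iso_verts f) (iso_verts f) ` parcs G"
    using a by (rule image_cong[OF refl])
  ultimately show ?R by metis
next
  interpret pair_wf_digraph G by fact
  assume ?R
  then obtain f where f: "inj_on f (pverts G)" "pverts H = f ` pverts G"
    "parcs H = map_prod f f ` parcs G" by blast
  have sub: "parcs G \<subseteq> pverts G \<times> pverts G"
    using arc_fst_in_verts arc_snd_in_verts by fastforce
  have "inj_on (map_prod f f) (parcs G)"
    using map_prod_inj_on[OF f(1) f(1)] sub by (rule inj_on_subset)
  then have "pre_digraph.digraph_isomorphism (with_proj G)
      \<lparr>iso_verts = f, iso_arcs = map_prod f f, iso_head = snd, iso_tail = fst\<rparr>"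
    using f(1) wf_digraph_axioms by (auto simp: pre_digraph.digraph_isomorphism_def)
  moreover have "with_proj H = app_iso
      \<lparr>iso_verts = f, iso_arcs = map_prod f f, iso_head = snd, iso_tail = fst\<rparr> (with_proj G)"
    using f by (simp add: with_proj_def app_iso_def)
  ultimately show ?L unfolding digraph_iso_def by blast
qed

lemma fin_digraphs_wf: "G \<in> fin_digraphs \<Longrightarrow> pair_wf_digraph G"
  by (simp add: fin_digraphs_def pair_fin_digraph_def)

lemma digraph_iso_rel_iff:
  "(G, H) \<in> digraph_iso_rel \<longleftrightarrow> G \<in> fin_digraphs \<and> H \<in> fin_digraphs \<and>
    (\<exists>f. inj_on f (pverts G) \<and> pverts H = f ` pverts G \<and> parcs H = map_prod f f ` parcs G)"
  using digraph_iso_with_proj_iff[OF fin_digraphs_wf] by (auto simp: digraph_iso_rel_def)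

lemma equiv_digraph_iso_rel: "equiv fin_digraphs digraph_iso_rel"
proof (rule equivI)
  show "digraph_iso_rel \<subseteq> fin_digraphs \<times> fin_digraphs"
    by (auto simp: digraph_iso_rel_def)
  show "refl_on fin_digraphs digraph_iso_rel"
    by (rule refl_onI) (auto simp: digraph_iso_rel_iff map_prod.id intro!: exI[of _ id])
  show "sym digraph_iso_rel"
  proof (rule symI)
    fix G H assume GH: "(G, H) \<in> digraph_iso_rel"
    then obtain f where G: "G \<in> fin_digraphs" and H: "H \<in> fin_digraphs"
      and f: "inj_on f (pverts G)" "pverts H = f ` pverts G" "parcs H = map_prod f f ` parcs G"
      by (auto simp: digraph_iso_rel_iff)
    interpret pair_wf_digraph G by (rule fin_digraphs_wf[OF G])
    let ?g = "inv_into (pverts G) f"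
    have "map_prod ?g ?g ` parcs H = (\<lambda>e. map_prod ?g ?g (map_prod f f e)) ` parcs G"
      by (simp add: f(3) image_image)
    also have "\<dots> = (\<lambda>e. e) ` parcs G"
    proof (rule image_cong[OF refl])
      fix e assume "e \<in> parcs G"
      then show "map_prod ?g ?g (map_prod f f e) = e"
        using f(1) by (cases e) (auto simp: inv_into_f_f dest: in_arcsD1 in_arcsD2)
    qed
    finally have "parcs G = map_prod ?g ?g ` parcs H" by simp
    moreover have "inj_on ?g (pverts H)" "pverts G = ?g ` pverts H"
      using f(1) by (auto simp: f(2) inj_on_inv_into image_image)
    ultimately show "(H, G) \<in> digraph_iso_rel"
      using G H unfolding digraph_iso_rel_iff by blast
  qed
  show "trans digraph_iso_rel"
  proof (rule transI)
    fix G H K assume "(G, H) \<in> digraph_iso_rel" "(H, K) \<in> digraph_iso_rel"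
    then obtain f g where GK: "G \<in> fin_digraphs" "K \<in> fin_digraphs"
      and f: "inj_on f (pverts G)" "pverts H = f ` pverts G" "parcs H = map_prod f f ` parcs G"
      and g: "inj_on g (pverts H)" "pverts K = g ` pverts H" "parcs K = map_prod g g ` parcs H"
      by (auto simp: digraph_iso_rel_iff)
    have "inj_on (g \<circ> f) (pverts G)" "pverts K = (g \<circ> f) ` pverts G"
      "parcs K = map_prod (g \<circ> f) (g \<circ> f) ` parcs G"
      using f g by (auto simp: image_comp map_prod.comp comp_inj_on)
    with GK show "(G, K) \<in> digraph_iso_rel"
      unfolding digraph_iso_rel_iff by blast
  qed
qed

lemma card_pverts_iso: "(G, H) \<in> digraph_iso_rel \<Longrightarrow> card (pverts G) = card (pverts H)"
  by (auto simp: digraph_iso_rel_iff card_image)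

lemma group_base_group: "group base_group"
  by (simp add: base_group_def DirProd_group group_BijGroup)

lemma carrier_base_group:
  "carrier base_group = {0..<2} \<times> {0..<2} \<times> {0..<2} \<times> {0..<2} \<times> {\<pi>. bij \<pi>}"
  by (simp add: base_group_def BijGroup_def Bij_def carrier_integer_mod_group)

lemma alpha_hom: "alpha \<in> hom (integer_mod_group 2) (AutoGroup base_group)"
proof -
  let ?t = "transpose LB LC"
  have tt: "?t \<circ> ?t = id" by (simp add: transpose_comp_involutory)
  have tt': "?t (?t x) = x" for x by simp
  have bt: "bij ?t" by simp
  have cl: "alpha 1 x \<in> carrier base_group" if "x \<in> carrier base_group" for x
    using that by (auto simp: alpha_def carrier_base_group intro!: bij_comp)
  have inv: "alpha 1 (alpha 1 x) = x" if "x \<in> carrier base_group" for x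
  proof -
    obtain p q r s \<pi> where x: "x = (p, q, r, s, \<pi>)" by (cases x) auto
    have "(q, p, s, r, ?t \<circ> \<pi> \<circ> ?t) \<in> carrier base_group"
      using cl[OF that] that by (simp add: alpha_def x)
    then show ?thesis using that by (simp add: alpha_def x fun_eq_iff)
  qed
  have bij: "alpha 1 \<in> Bij (carrier base_group)"
    unfolding Bij_def
    by (auto intro!: bij_betw_byWitness[where f' = "alpha 1"] simp: inv cl)
       (auto simp: alpha_def)
  have "alpha 1 (x \<otimes>\<^bsub>base_group\<^esub> y) = alpha 1 x \<otimes>\<^bsub>base_group\<^esub> alpha 1 y"
    if x: "x \<in> carrier base_group" and y: "y \<in> carrier base_group" for x y
  proof -
    have xy: "x \<otimes>\<^bsub>base_group\<^esub> y \<in> carrier base_group"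
      by (meson group_base_group group.is_monoid monoid.m_closed x y)
    obtain p q r s \<pi> where x': "x = (p, q, r, s, \<pi>)" by (cases x) auto
    obtain p' q' r' s' \<pi>' where y': "y = (p', q', r', s', \<pi>')" by (cases y) auto
    have b: "bij \<pi>" "bij \<pi>'" using x y by (auto simp: x' y' carrier_base_group)
    then have b': "bij (?t \<circ> \<pi> \<circ> ?t)" "bij (?t \<circ> \<pi>' \<circ> ?t)" by (auto intro!: bij_comp)
    show ?thesis
      using x y xy b b'
      by (simp add: alpha_def x' y')
         (simp add: base_group_def BijGroup_def Bij_def compose_def fun_eq_iff)
  qed
  then have "alpha 1 \<in> auto base_group"
    using bij cl by (auto simp: auto_def hom_def)
  moreover have "alpha 0 \<in> auto base_group"
    using group.id_in_auto[OF group_base_group] by (simp add: alpha_def)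
  moreover have "alpha 0 \<in> Bij (carrier base_group)"
    using calculation by (simp add: auto_def)
  moreover have "compose (carrier base_group) (alpha 1) (alpha 1) = alpha 0"
    by (auto simp: compose_def fun_eq_iff alpha_def[of 0] inv)
  moreover have "compose (carrier base_group) (alpha 0) (alpha k) = alpha k"
     "compose (carrier base_group) (alpha k) (alpha 0) = alpha k"
    if "k = 0 \<or> k = 1" for k
    using that cl bij by (auto simp: compose_def fun_eq_iff alpha_def)
  moreover have "{0..<2} = {0, 1 :: int}" by auto
  ultimately show ?thesis
    using bij
    by (auto simp: hom_def AutoGroup_def BijGroup_def carrier_integer_mod_group
        mult_integer_mod_group)
qed

lemma group_semidirect_product:
  assumes "group N" "group K" and \<theta>: "\<theta> \<in> hom K (AutoGroup N)"
  shows "group (semidirect_product N K \<theta>)"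
proof -
  interpret N: group N by fact
  interpret K: group K by fact
  have aut: "\<theta> k \<in> auto N" if "k \<in> carrier K" for k
    using \<theta> that by (auto simp: hom_def AutoGroup_def)
  have cl: "\<theta> k x \<in> carrier N" if "k \<in> carrier K" "x \<in> carrier N" for k x
    using aut[OF that(1)] that(2) by (auto simp: auto_def hom_def)
  have hm: "\<theta> k (x \<otimes>\<^bsub>N\<^esub> y) = \<theta> k x \<otimes>\<^bsub>N\<^esub> \<theta> k y"
    if "k \<in> carrier K" "x \<in> carrier N" "y \<in> carrier N" for k x y
    using aut[OF that(1)] that by (auto simp: auto_def hom_def)
  have mul: "\<theta> (k \<otimes>\<^bsub>K\<^esub> l) x = \<theta> k (\<theta> l x)"
    if "k \<in> carrier K" "l \<in> carrier K" "x \<in> carrier N" for k l x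
    using \<theta> that aut[OF that(1)] aut[OF that(2)]
    by (auto simp: hom_def AutoGroup_def BijGroup_def auto_def compose_def)
  have one: "\<theta> \<one>\<^bsub>K\<^esub> x = x" if "x \<in> carrier N" for x
  proof -
    have "inj_on (\<theta> \<one>\<^bsub>K\<^esub>) (carrier N)"
      using aut[of "\<one>\<^bsub>K\<^esub>"] by (auto simp: auto_def Bij_def bij_betw_def)
    moreover have "\<theta> \<one>\<^bsub>K\<^esub> (\<theta> \<one>\<^bsub>K\<^esub> x) = \<theta> \<one>\<^bsub>K\<^esub> x"
      using mul[of "\<one>\<^bsub>K\<^esub>" "\<one>\<^bsub>K\<^esub>" x] that by simp
    ultimately show ?thesis
      using that cl by (meson K.one_closed inj_onD)
  qed
  show ?thesis
  proof (rule groupI)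
    fix z assume "z \<in> carrier (semidirect_product N K \<theta>)"
    then obtain x k where z: "z = (x, k)" "x \<in> carrier N" "k \<in> carrier K"
      by (auto simp: semidirect_product_def)
    have "\<theta> (inv\<^bsub>K\<^esub> k) (inv\<^bsub>N\<^esub> x) \<otimes>\<^bsub>N\<^esub> \<theta> (inv\<^bsub>K\<^esub> k) x = \<theta> (inv\<^bsub>K\<^esub> k) \<one>\<^bsub>N\<^esub>"
      using hm[of "inv\<^bsub>K\<^esub> k" "inv\<^bsub>N\<^esub> x" x] z by simp
    also have "\<dots> = \<one>\<^bsub>N\<^esub>"
      using hm[of "inv\<^bsub>K\<^esub> k" "\<one>\<^bsub>N\<^esub>" "\<one>\<^bsub>N\<^esub>"] cl[of "inv\<^bsub>K\<^esub> k" "\<one>\<^bsub>N\<^esub>"] z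
      by (metis K.inv_closed N.l_cancel_one N.l_one N.one_closed)
    finally show "\<exists>y\<in>carrier (semidirect_product N K \<theta>).
        y \<otimes>\<^bsub>semidirect_product N K \<theta>\<^esub> z = \<one>\<^bsub>semidirect_product N K \<theta>\<^esub>"
      using z cl
      by (intro bexI[of _ "(\<theta> (inv\<^bsub>K\<^esub> k) (inv\<^bsub>N\<^esub> x), inv\<^bsub>K\<^esub> k)"])
         (auto simp: semidirect_product_def)
  qed (auto simp: semidirect_product_def cl hm mul one N.m_assoc K.m_assoc)
qed

lemma group_C_group: "group C_group"
  unfolding C_group_def
  by (intro group_semidirect_product group_base_group alpha_hom) simp

end

theory Submission
  imports Defs "HOL-Combinatorics.Permutations"
begin

text \<open>
  A digraph is given by its loops together with, for each pair of vertices, one of four states of the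
  two possible arcs.  Complementing the loops, permuting the four states of a pair consisting of a
  looped and an unlooped vertex, and exchanging empty with full pairs or reversing single arcs among
  the unlooped (or among the looped) vertices are local recodings: they commute with passing to
  induced subgraphs, so \<^term>\<open>C_group\<close> acts on all levels.

  Conversely, let an automorphism of the first four levels be given.  After composing it with such
  recodings it fixes all digraphs with at most two vertices; that single arcs are fixed is seen from
  the tournaments on three vertices.  Digraphs on three vertices of which exactly one is looped are
  then fixed up to reversing the arc between the other two, depending only on the labels \<open>l\<close>, \<open>m\<close> of
  the two mixed pairs.  Adding to an unlooped digraph \<open>T\<close> on three vertices a looped vertex with three
  distinct labels shows that \<open>T\<close> is mapped to the digraph obtained by the corresponding three
  reversals.  These must all take place or all fail, for otherwise the cyclic and some transitive
  tournament would have the same image.  The looped vertices behave symmetrically.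
\<close>

section \<open>Embeddings and isomorphism types\<close>

definition size_of :: "nat pair_pre_digraph \<Rightarrow> nat" where
  "size_of G = card (pverts G)"

definition is_emb :: "(nat \<Rightarrow> nat) \<Rightarrow> nat pair_pre_digraph \<Rightarrow> nat pair_pre_digraph \<Rightarrow> bool" where
  "is_emb f G H \<longleftrightarrow> inj_on f (pverts G) \<and> f ` pverts G \<subseteq> pverts H \<and>
     (\<forall>x\<in>pverts G. \<forall>y\<in>pverts G. (f x, f y) \<in> parcs H \<longleftrightarrow> (x, y) \<in> parcs G)"

definition embeds :: "nat pair_pre_digraph \<Rightarrow> nat pair_pre_digraph \<Rightarrow> bool" where
  "embeds G H \<longleftrightarrow> (\<exists>f. is_emb f G H)"

definition dg :: "nat set \<Rightarrow> (nat \<Rightarrow> nat \<Rightarrow> bool) \<Rightarrow> nat pair_pre_digraph" where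
  "dg V R = \<lparr>pverts = V, parcs = {(x, y). x \<in> V \<and> y \<in> V \<and> R x y}\<rparr>"

definition type_of :: "nat pair_pre_digraph \<Rightarrow> iso_type" where
  "type_of G = digraph_iso_rel `` {G}"

lemma pverts_dg [simp]: "pverts (dg V R) = V"
  and parcs_dg [simp]: "(x, y) \<in> parcs (dg V R) \<longleftrightarrow> x \<in> V \<and> y \<in> V \<and> R x y"
  by (auto simp: dg_def)

lemma fin_digraphs_iff:
  "G \<in> fin_digraphs \<longleftrightarrow> finite (pverts G) \<and> pverts G \<noteq> {} \<and> parcs G \<subseteq> pverts G \<times> pverts G"
proof
  assume G: "G \<in> fin_digraphs"
  then interpret pair_fin_digraph G by (simp add: fin_digraphs_def)
  show "finite (pverts G) \<and> pverts G \<noteq> {} \<and> parcs G \<subseteq> pverts G \<times> pverts G"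
    using G by (auto simp: fin_digraphs_def dest: in_arcsD1 in_arcsD2)
next
  assume *: "finite (pverts G) \<and> pverts G \<noteq> {} \<and> parcs G \<subseteq> pverts G \<times> pverts G"
  then have "finite (parcs G)" by (meson finite_SigmaI finite_subset)
  with * show "G \<in> fin_digraphs"
    by (force simp: fin_digraphs_def intro!: pair_fin_digraph.intro pair_wf_digraph.intro
        pair_fin_digraph_axioms.intro)
qed

lemma dg_fin [simp]: "dg V R \<in> fin_digraphs \<longleftrightarrow> finite V \<and> V \<noteq> {}"
  by (auto simp: fin_digraphs_iff dg_def)

lemma digraph_eqI:
  assumes "G \<in> fin_digraphs" "H \<in> fin_digraphs" "pverts G = pverts H"
    and "\<And>x y. x \<in> pverts G \<Longrightarrow> y \<in> pverts G \<Longrightarrow> (x, y) \<in> parcs G \<longleftrightarrow> (x, y) \<in> parcs H"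
  shows "G = H"
proof -
  have "parcs G = parcs H"
    using assms unfolding fin_digraphs_iff by (intro equalityI subrelI) blast+
  then show ?thesis using assms(3) by simp
qed

lemma size_of_pos: "G \<in> fin_digraphs \<Longrightarrow> 0 < size_of G"
  by (auto simp: size_of_def fin_digraphs_iff card_gt_0_iff)

text \<open>Passes between the image form of an isomorphism and the pointwise form in
  \<open>is_emb\<close>. The two agree because members of \<open>fin_digraphs\<close> have arcs only
  between their own vertices.\<close>

lemma is_emb_iso:
  assumes "G \<in> fin_digraphs" "H \<in> fin_digraphs"
  shows "inj_on f (pverts G) \<and> pverts H = f ` pverts G \<and> parcs H = map_prod f f ` parcs G
    \<longleftrightarrow> is_emb f G H \<and> f ` pverts G = pverts H" (is "?L \<longleftrightarrow> ?R")
proof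
  assume L: ?L
  have "(x, y) \<in> parcs G" if "(f x, f y) \<in> parcs H" "x \<in> pverts G" "y \<in> pverts G" for x y
  proof -
    have "(f x, f y) \<in> map_prod f f ` parcs G" using L that(1) by simp
    then obtain a b where "(a, b) \<in> parcs G" "f x = f a" "f y = f b" by auto
    moreover have "a \<in> pverts G" "b \<in> pverts G" using assms calculation by (auto simp: fin_digraphs_iff)
    ultimately show ?thesis using L that by (metis inj_onD)
  qed
  moreover have "(f x, f y) \<in> parcs H" if "(x, y) \<in> parcs G" for x y
    using L that by (metis imageI map_prod_simp)
  ultimately show ?R using L unfolding is_emb_def by blast
next
  assume R: ?R
  have "parcs H = map_prod f f ` parcs G"
  proof (intro equalityI subsetI)
    fix e assume e: "e \<in> parcs H"
    then have "e \<in> f ` pverts G \<times> f ` pverts G" using R assms(2) by (auto simp: fin_digraphs_iff)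
    then obtain x y where "e = (f x, f y)" "x \<in> pverts G" "y \<in> pverts G" by blast
    then show "e \<in> map_prod f f ` parcs G" using R e by (auto simp: is_emb_def)
  next
    fix e assume "e \<in> map_prod f f ` parcs G"
    then show "e \<in> parcs H" using R assms(1) by (auto simp: fin_digraphs_iff is_emb_def)
  qed
  then show ?L using R by (auto simp: is_emb_def)
qed

lemma digraph_iso_rel_emb:
  "(G, H) \<in> digraph_iso_rel \<longleftrightarrow> G \<in> fin_digraphs \<and> H \<in> fin_digraphs \<and>
     (\<exists>f. is_emb f G H \<and> f ` pverts G = pverts H)"
  using is_emb_iso unfolding digraph_iso_rel_iff by (metis (no_types, lifting))

lemma is_emb_comp: "is_emb f G H \<Longrightarrow> is_emb g H K \<Longrightarrow> is_emb (g \<circ> f) G K"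
  unfolding is_emb_def image_subset_iff inj_on_def by simp

lemma embeds_trans: "embeds G H \<Longrightarrow> embeds H K \<Longrightarrow> embeds G K"
  using is_emb_comp unfolding embeds_def by blast

lemma iso_imp_embeds:
  assumes "(G, H) \<in> digraph_iso_rel" shows "embeds G H" "embeds H G"
  using assms equiv_digraph_iso_rel unfolding embeds_def
  by (meson digraph_iso_rel_emb equivE symE)+

lemma type_of_eq_iso_rel:
  "G \<in> fin_digraphs \<Longrightarrow> H \<in> fin_digraphs \<Longrightarrow> type_of G = type_of H \<longleftrightarrow> (G, H) \<in> digraph_iso_rel"
  unfolding type_of_def using eq_equiv_class_iff[OF equiv_digraph_iso_rel] by blast

text \<open>An injection into a finite set of the same size is onto, so an embedding between
  digraphs of equal size is an isomorphism.\<close>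

lemma type_of_eq_iff:
  assumes G: "G \<in> fin_digraphs" and H: "H \<in> fin_digraphs"
  shows "type_of G = type_of H \<longleftrightarrow> embeds G H \<and> size_of G = size_of H"
proof
  assume "type_of G = type_of H"
  then have "(G, H) \<in> digraph_iso_rel" using type_of_eq_iso_rel G H by blast
  then show "embeds G H \<and> size_of G = size_of H"
    using card_pverts_iso iso_imp_embeds by (auto simp: size_of_def)
next
  assume "embeds G H \<and> size_of G = size_of H"
  then obtain f where f: "is_emb f G H" and c: "card (pverts G) = card (pverts H)"
    by (auto simp: embeds_def size_of_def)
  have "f ` pverts G = pverts H"
    using f c H by (metis card_image card_subset_eq fin_digraphs_iff is_emb_def)
  then show "type_of G = type_of H" using f G H type_of_eq_iso_rel digraph_iso_rel_emb by blast
qed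

lemma embeds_size: "embeds G H \<Longrightarrow> H \<in> fin_digraphs \<Longrightarrow> size_of G \<le> size_of H"
  unfolding embeds_def is_emb_def size_of_def fin_digraphs_iff using card_inj_on_le by blast

lemma type_of_embedsI:
  assumes "G \<in> fin_digraphs" "H \<in> fin_digraphs" "embeds G H" "size_of H \<le> size_of G"
  shows "type_of G = type_of H"
  using assms embeds_size type_of_eq_iff by (meson le_antisym)

lemma iso_types_type_of: "iso_types = type_of ` fin_digraphs"
  by (auto simp: iso_types_def quotient_def type_of_def)

lemma type_of_in [simp]: "G \<in> fin_digraphs \<Longrightarrow> type_of G \<in> iso_types"
  by (simp add: iso_types_type_of)

lemma mem_type_of: "K \<in> type_of G \<longleftrightarrow> (G, K) \<in> digraph_iso_rel"
  by (simp add: type_of_def)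

lemma self_mem_type_of: "G \<in> fin_digraphs \<Longrightarrow> G \<in> type_of G"
  using equiv_class_self[OF equiv_digraph_iso_rel] by (simp add: type_of_def)

text \<open>The inclusion of an induced subgraph is an embedding, and the image of an embedding
  spans an induced subgraph.\<close>

lemma induced_subgraph_embeds:
  assumes G: "G \<in> fin_digraphs" and H: "H \<in> fin_digraphs"
  shows "(\<exists>K. induced_subgraph (with_proj K) (with_proj H) \<and> digraph_iso (with_proj G) (with_proj K))
    \<longleftrightarrow> embeds G H" (is "?L \<longleftrightarrow> ?R")
proof
  assume ?L
  then obtain K where K: "induced_subgraph (with_proj K) (with_proj H)"
    and iso: "digraph_iso (with_proj G) (with_proj K)" by blast
  have sub: "pverts K \<subseteq> pverts H"
    "parcs K = {e \<in> parcs H. fst e \<in> pverts K \<and> snd e \<in> pverts K}"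
    using K by (auto simp: induced_subgraph_def subgraph_def)
  obtain f where f: "inj_on f (pverts G)" "pverts K = f ` pverts G" "parcs K = map_prod f f ` parcs G"
    using iso unfolding digraph_iso_with_proj_iff[OF fin_digraphs_wf[OF G]] by blast
  have "K \<in> fin_digraphs"
    using G f unfolding fin_digraphs_iff by (auto simp: image_iff) 
  then have "is_emb f G K" using is_emb_iso[OF G, of K f] f by simp
  moreover have "is_emb id K H" using sub by (auto simp: is_emb_def)
  ultimately show ?R using is_emb_comp embeds_def by blast
next
  assume ?R
  then obtain f where f: "is_emb f G H" by (auto simp: embeds_def)
  define K where "K = dg (f ` pverts G) (\<lambda>x y. (x, y) \<in> parcs H)"
  have K: "K \<in> fin_digraphs" using G by (auto simp: K_def fin_digraphs_iff)
  have "is_emb f G K \<and> f ` pverts G = pverts K"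
    using f by (auto simp: is_emb_def K_def)
  then have "digraph_iso (with_proj G) (with_proj K)"
    unfolding digraph_iso_with_proj_iff[OF fin_digraphs_wf[OF G]] is_emb_iso[OF G K] by blast
  moreover have "induced_subgraph (with_proj K) (with_proj H)"
    using f fin_digraphs_wf[OF K] fin_digraphs_wf[OF H]
    by (auto simp: induced_subgraph_def subgraph_def compatible_def wf_digraph_wp_iff K_def dg_def is_emb_def)
  ultimately show ?L by blast
qed

text \<open>\<open>embeds\<close> is invariant under isomorphism on both sides, so the
  representatives chosen existentially in \<open>emb\<close> may be any.\<close>

lemma emb_type_of:
  assumes G: "G \<in> fin_digraphs" and H: "H \<in> fin_digraphs"
  shows "type_of G \<sqsubseteq>\<^sub>D type_of H \<longleftrightarrow> embeds G H"
proof -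
  have *: "G' \<in> fin_digraphs" "embeds G' G" "embeds G G'" if "G' \<in> type_of G" for G' G
    using that iso_imp_embeds by (auto simp: mem_type_of digraph_iso_rel_emb)
  have "type_of G \<sqsubseteq>\<^sub>D type_of H \<longleftrightarrow> (\<exists>G'\<in>type_of G. \<exists>H'\<in>type_of H. embeds G' H')"
    unfolding emb_def using induced_subgraph_embeds * by meson
  also have "\<dots> \<longleftrightarrow> embeds G H"
    using * self_mem_type_of[OF G] self_mem_type_of[OF H] embeds_trans by meson
  finally show ?thesis .
qed

section \<open>The levels of the poset\<close>

lemma size_of_mem: "K \<in> type_of G \<Longrightarrow> size_of K = size_of G"
  using card_pverts_iso by (auto simp: mem_type_of size_of_def)

lemma type_of_in_first_levels:
  assumes "G \<in> fin_digraphs"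
  shows "type_of G \<in> first_levels n P \<longleftrightarrow> type_of G \<in> P \<and> size_of G \<le> n"
proof -
  have "(\<exists>K\<in>type_of G. size_of K \<le> n) \<longleftrightarrow> size_of G \<le> n"
    using self_mem_type_of[OF assms] size_of_mem by metis
  then show ?thesis by (simp add: first_levels_def size_of_def)
qed

lemma type_of_in_levels [simp]:
  assumes "G \<in> fin_digraphs"
  shows "type_of G \<in> first_levels n iso_types \<longleftrightarrow> size_of G \<le> n"
  using assms by (simp add: type_of_in_first_levels)

lemma first_levels_iso_types: "first_levels n iso_types = type_of ` {G \<in> fin_digraphs. size_of G \<le> n}"
  using type_of_in_levels by (auto simp: iso_types_type_of first_levels_def)

text \<open>Restricting automorphisms of the first \<open>n\<close> levels to the first
  \<open>m\<close> produces this nested expression.\<close>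

lemma first_levels_first_levels:
  assumes "m \<le> n"
  shows "first_levels m (first_levels n iso_types) = first_levels m iso_types"
proof -
  have "X \<in> first_levels m (first_levels n iso_types) \<longleftrightarrow> X \<in> first_levels m iso_types"
    if "X \<in> iso_types" for X
    using that assms by (auto simp: iso_types_type_of type_of_in_first_levels)
  then show ?thesis by (auto simp: first_levels_def)
qed

section \<open>The action of the group of order 768\<close>

text \<open>The letters are the states of a mixed pair: the first argument is the arc leaving the
  looped vertex, the second the arc entering it. \<open>LB\<close> and \<open>LC\<close> are the
  single arcs, so reading the pair from its other end is the transposition of these two
  letters.\<close>

fun enc :: "bool \<Rightarrow> bool \<Rightarrow> letter" where
  "enc False False = LA"
| "enc True False = LB"
| "enc False True = LC"
| "enc True True = LD"

definition dec1 :: "letter \<Rightarrow> bool" where "dec1 l \<longleftrightarrow> l = LB \<or> l = LD"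
definition dec2 :: "letter \<Rightarrow> bool" where "dec2 l \<longleftrightarrow> l = LC \<or> l = LD"

lemma enc_dec [simp]: "enc (dec1 l) (dec2 l) = l" "dec1 (enc a b) = a" "dec2 (enc a b) = b"
  by (cases l; simp add: dec1_def dec2_def) (cases a; cases b; simp add: dec1_def dec2_def)+

lemma transpose_enc [simp]: "transpose LB LC (enc a b) = enc b a"
  by (cases a; cases b; simp add: transpose_def)

text \<open>In \<open>new_arc x u v a b\<close>, \<open>u\<close> and \<open>v\<close> tell whether the tail and the head are looped after a possible
  complementation of the loops, \<open>a\<close> is the old arc and \<open>b\<close> the old arc in the opposite direction.  The
  letter of a mixed pair is read from its looped end.\<close>

fun new_arc :: "base_elem \<Rightarrow> bool \<Rightarrow> bool \<Rightarrow> bool \<Rightarrow> bool \<Rightarrow> bool" where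
  "new_arc (p, q, r, s, \<pi>) False False a b = (if a = b then a \<noteq> (p = 1) else a \<noteq> (r = 1))"
| "new_arc (p, q, r, s, \<pi>) True True a b = (if a = b then a \<noteq> (q = 1) else a \<noteq> (s = 1))"
| "new_arc (p, q, r, s, \<pi>) True False a b = dec1 (\<pi> (enc a b))"
| "new_arc (p, q, r, s, \<pi>) False True a b = dec2 (\<pi> (enc b a))"

text \<open>Loops are complemented first and the pairs are then recoded according to the new loops.
  This order matches the factorization of \<open>(x, k)\<close> into \<open>x\<close> after
  \<open>k\<close> in the semidirect product.\<close>

definition act :: "base_elem \<times> int \<Rightarrow> nat pair_pre_digraph \<Rightarrow> nat pair_pre_digraph" where
  "act c G = dg (pverts G) (\<lambda>x y.
     let l = (\<lambda>x. ((x, x) \<in> parcs G) \<noteq> (snd c = 1))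
     in if x = y then l x else new_arc (fst c) (l x) (l y) ((x, y) \<in> parcs G) ((y, x) \<in> parcs G))"

definition act_type :: "base_elem \<times> int \<Rightarrow> iso_type \<Rightarrow> iso_type" where
  "act_type c X = act c ` X"

section \<open>The group law in coordinates\<close>

lemma mult_base_group:
  assumes "x \<in> carrier base_group" "y \<in> carrier base_group"
  shows "x \<otimes>\<^bsub>base_group\<^esub> y = (case (x, y) of ((p, q, r, s, \<pi>), (p', q', r', s', \<pi>')) \<Rightarrow>
    ((p + p') mod 2, (q + q') mod 2, (r + r') mod 2, (s + s') mod 2, \<pi> \<circ> \<pi>'))"
  using assms unfolding carrier_base_group
  by (auto simp: base_group_def mult_integer_mod_group BijGroup_def Bij_def compose_def fun_eq_iff)

lemma one_base_group: "\<one>\<^bsub>base_group\<^esub> = (0, 0, 0, 0, id)"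
  by (auto simp: base_group_def BijGroup_def one_integer_mod_group)

lemma carrier_C_group: "carrier C_group = carrier base_group \<times> {0..<2}"
  by (simp add: C_group_def semidirect_product_def carrier_integer_mod_group)

lemma one_C_group: "\<one>\<^bsub>C_group\<^esub> = ((0, 0, 0, 0, id), 0)"
  by (simp add: C_group_def semidirect_product_def one_base_group one_integer_mod_group)

lemma mult_C_group:
  "(x, k) \<otimes>\<^bsub>C_group\<^esub> (y, l) = (x \<otimes>\<^bsub>base_group\<^esub> alpha k y, (k + l) mod 2)"
  by (simp add: C_group_def semidirect_product_def mult_integer_mod_group)

lemma mod2_sum_eq_1: "p \<in> {0..<2} \<Longrightarrow> q \<in> {0..<2} \<Longrightarrow> (p + q) mod 2 = (1::int) \<longleftrightarrow> (p = 1) \<noteq> (q = 1)"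
proof -
  assume "p \<in> {0..<2}" "q \<in> {0..<2}"
  then have "p = 0 \<or> p = 1" "q = 0 \<or> q = 1" by auto
  then show ?thesis by auto
qed

lemma alpha_carrier:
  assumes "k \<in> {0..<2}" "y \<in> carrier base_group" shows "alpha k y \<in> carrier base_group"
  using assms alpha_hom
  by (auto simp: hom_def AutoGroup_def auto_def carrier_integer_mod_group)

text \<open>The reason for the form of \<open>alpha\<close>: \<open>y\<close> acts before the loops
  are complemented by \<open>k\<close>. Pushing it past a complementation turns unlooped vertices
  into looped ones, which exchanges \<open>p\<close> with \<open>q\<close> and \<open>r\<close> with
  \<open>s\<close>, and moves the looped end of a mixed pair to the other vertex, which conjugates
  the letter permutation by the transposition of \<open>LB\<close> and \<open>LC\<close>.\<close>

lemma new_arc_mult: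
  assumes x: "x \<in> carrier base_group" and y: "y \<in> carrier base_group" and k: "k \<in> {0..<2}"
  shows "new_arc (x \<otimes>\<^bsub>base_group\<^esub> alpha k y) u v a b =
    new_arc x u v (new_arc y (u \<noteq> (k = 1)) (v \<noteq> (k = 1)) a b)
                  (new_arc y (v \<noteq> (k = 1)) (u \<noteq> (k = 1)) b a)"
proof -
  obtain p q r s \<pi> where x': "x = (p, q, r, s, \<pi>)" by (cases x) auto
  obtain p' q' r' s' \<pi>' where y': "y = (p', q', r', s', \<pi>')" by (cases y) auto
  have m: "p \<in> {0..<2}" "q \<in> {0..<2}" "r \<in> {0..<2}" "s \<in> {0..<2}"
     "p' \<in> {0..<2}" "q' \<in> {0..<2}" "r' \<in> {0..<2}" "s' \<in> {0..<2}"
    using x y by (auto simp: x' y' carrier_base_group)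
  note M = mod2_sum_eq_1[OF m(1) m(5)] mod2_sum_eq_1[OF m(2) m(6)] mod2_sum_eq_1[OF m(3) m(7)]
    mod2_sum_eq_1[OF m(4) m(8)] mod2_sum_eq_1[OF m(1) m(6)] mod2_sum_eq_1[OF m(2) m(5)]
    mod2_sum_eq_1[OF m(3) m(8)] mod2_sum_eq_1[OF m(4) m(7)]
  have tr: "transpose LB LC l = enc (dec2 l) (dec1 l)" for l
    using transpose_enc[of "dec1 l" "dec2 l"] by simp
  consider "k = 0" | "k = 1" using k by force
  then show ?thesis
  proof cases
    case 1
    then have "x \<otimes>\<^bsub>base_group\<^esub> alpha k y =
        ((p + p') mod 2, (q + q') mod 2, (r + r') mod 2, (s + s') mod 2, \<pi> \<circ> \<pi>')"
      using x y by (simp add: alpha_def mult_base_group x' y')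
    with 1 show ?thesis
      unfolding x' y' by (cases u; cases v; simp only: new_arc.simps M comp_apply; auto)
  next
    case 2
    then have "alpha k y = (q', p', s', r', transpose LB LC \<circ> \<pi>' \<circ> transpose LB LC)"
      using y by (simp add: alpha_def y')
    then have "x \<otimes>\<^bsub>base_group\<^esub> alpha k y =
        ((p + q') mod 2, (q + p') mod 2, (r + s') mod 2, (s + r') mod 2,
         \<pi> \<circ> (transpose LB LC \<circ> \<pi>' \<circ> transpose LB LC))"
      using mult_base_group[OF x alpha_carrier[OF k y]] by (simp add: x')
    with 2 show ?thesis
      unfolding x' y' by (cases u; cases v; simp only: new_arc.simps M comp_apply tr; auto)
  qed
qed

section \<open>The action on digraphs\<close>

lemma pverts_act [simp]: "pverts (act c G) = pverts G"
  by (simp add: act_def)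

lemma size_of_act [simp]: "size_of (act c G) = size_of G"
  by (simp add: size_of_def)

lemma act_fin [simp]: "G \<in> fin_digraphs \<Longrightarrow> act c G \<in> fin_digraphs"
  by (auto simp: act_def fin_digraphs_iff)

lemma loop_act [simp]: "x \<in> pverts G \<Longrightarrow> (x, x) \<in> parcs (act c G) \<longleftrightarrow> ((x, x) \<in> parcs G) \<noteq> (snd c = 1)"
  by (simp add: act_def)

lemma arc_act:
  "x \<in> pverts G \<Longrightarrow> y \<in> pverts G \<Longrightarrow> x \<noteq> y \<Longrightarrow> (x, y) \<in> parcs (act c G) \<longleftrightarrow>
     new_arc (fst c) (((x, x) \<in> parcs G) \<noteq> (snd c = 1)) (((y, y) \<in> parcs G) \<noteq> (snd c = 1))
       ((x, y) \<in> parcs G) ((y, x) \<in> parcs G)"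
  by (simp add: act_def)

lemma act_mult:
  assumes c: "c \<in> carrier C_group" and d: "d \<in> carrier C_group" and G: "G \<in> fin_digraphs"
  shows "act (c \<otimes>\<^bsub>C_group\<^esub> d) G = act c (act d G)"
proof (rule digraph_eqI)
  obtain x k y l where cd: "c = (x, k)" "d = (y, l)" by (cases c; cases d) auto
  have m: "x \<in> carrier base_group" "y \<in> carrier base_group" "k \<in> {0..<2}" "l \<in> {0..<2}"
    using c d by (auto simp: cd carrier_C_group)
  fix a b assume "a \<in> pverts (act (c \<otimes>\<^bsub>C_group\<^esub> d) G)" "b \<in> pverts (act (c \<otimes>\<^bsub>C_group\<^esub> d) G)"
  then have ab: "a \<in> pverts G" "b \<in> pverts G" by auto
  \<comment> \<open>Exclusive-or identities for the loop marks; the mark that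
    \<open>new_arc_mult\<close> hands to \<open>y\<close> contains \<open>k\<close> twice.\<close>
  have *: "((P \<noteq> Q) \<noteq> R) = (P \<noteq> (R \<noteq> Q))" "((P \<noteq> (R \<noteq> Q)) \<noteq> R) = (P \<noteq> Q)"
    "(P \<noteq> (R \<noteq> (R \<noteq> Q))) = (P \<noteq> Q)" for P Q R by auto
  show "((a, b) \<in> parcs (act (c \<otimes>\<^bsub>C_group\<^esub> d) G)) = ((a, b) \<in> parcs (act c (act d G)))"
  proof (cases "a = b")
    case True
    then show ?thesis using ab m by (simp add: cd mult_C_group mod2_sum_eq_1) blast
  next
    case False
    then show ?thesis
      using ab m
      by (simp only: arc_act pverts_act loop_act cd mult_C_group fst_conv snd_conv mod2_sum_eq_1
          new_arc_mult * not_sym[OF False] not_False_eq_True)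
  qed
qed (use G in auto)

lemma act_one: "G \<in> fin_digraphs \<Longrightarrow> act \<one>\<^bsub>C_group\<^esub> G = G"
proof (rule digraph_eqI)
  have *: "new_arc (0, 0, 0, 0, id) u v a b = a" for u v a b
    by (cases u; cases v) auto
  fix a b assume "a \<in> pverts (act \<one>\<^bsub>C_group\<^esub> G)" "b \<in> pverts (act \<one>\<^bsub>C_group\<^esub> G)"
  then show "((a, b) \<in> parcs (act \<one>\<^bsub>C_group\<^esub> G)) = ((a, b) \<in> parcs G)"
    by (cases "a = b") (auto simp: one_C_group arc_act *)
qed auto

text \<open>The same map stays an embedding, since the new state of a pair depends only on the old
  pair and on the loops at its ends.\<close>

lemma act_embeds: "embeds G H \<Longrightarrow> embeds (act c G) (act c H)"
proof -
  assume "embeds G H"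
  then obtain f where f: "is_emb f G H" by (auto simp: embeds_def)
  have "is_emb f (act c G) (act c H)"
    unfolding is_emb_def
  proof (intro conjI ballI)
    fix x y assume "x \<in> pverts (act c G)" "y \<in> pverts (act c G)"
    moreover have "f x = f y \<longleftrightarrow> x = y" 
      using calculation f by (auto simp: is_emb_def inj_on_def)
    ultimately show "((f x, f y) \<in> parcs (act c H)) = ((x, y) \<in> parcs (act c G))"
      using f unfolding is_emb_def by (cases "x = y") (simp_all add: arc_act image_subset_iff)
  qed (use f in \<open>auto simp: is_emb_def\<close>)
  then show ?thesis by (auto simp: embeds_def)
qed

section \<open>Inverses and the induced action on isomorphism types\<close>

interpretation C: group C_group by (rule group_C_group)

lemma act_inv:
  assumes "c \<in> carrier C_group" "G \<in> fin_digraphs"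
  shows "act c (act (inv\<^bsub>C_group\<^esub> c) G) = G" "act (inv\<^bsub>C_group\<^esub> c) (act c G) = G"
  using assms act_mult[of c "inv\<^bsub>C_group\<^esub> c" G] act_mult[of "inv\<^bsub>C_group\<^esub> c" c G]
  by (simp_all add: act_one)

text \<open>One inclusion holds as \<open>act\<close> preserves embeddings; the other applies this
  to the inverse of \<open>c\<close>, so the image fills the whole class.\<close>

lemma act_type_type_of:
  assumes c: "c \<in> carrier C_group" and G: "G \<in> fin_digraphs"
  shows "act_type c (type_of G) = type_of (act c G)"
proof -
  have *: "act d K \<in> type_of (act d G)" if "K \<in> type_of G" "G \<in> fin_digraphs" for d K G
  proof -
    have K: "K \<in> fin_digraphs" "type_of G = type_of K"
      using that type_of_eq_iso_rel by (auto simp: mem_type_of digraph_iso_rel_emb)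
    then have "type_of (act d G) = type_of (act d K)"
      using that act_embeds type_of_eq_iff by auto
    then show ?thesis using K self_mem_type_of by auto
  qed
  have "K \<in> act c ` type_of G" if "K \<in> type_of (act c G)" for K
  proof -
    have K: "K \<in> fin_digraphs" using that by (auto simp: mem_type_of digraph_iso_rel_emb)
    have "act (inv\<^bsub>C_group\<^esub> c) K \<in> type_of G"
      using *[OF that, of "inv\<^bsub>C_group\<^esub> c"] G act_inv[OF c G] by simp
    then show ?thesis using act_inv(1)[OF c K] by (metis imageI)
  qed
  then show ?thesis using *[OF _ G, of _ c] unfolding act_type_def by blast
qed

lemma act_type_mult:
  "c \<in> carrier C_group \<Longrightarrow> d \<in> carrier C_group \<Longrightarrow> X \<in> iso_types \<Longrightarrow>
     act_type (c \<otimes>\<^bsub>C_group\<^esub> d) X = act_type c (act_type d X)"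
  by (auto simp: iso_types_type_of act_type_type_of act_mult)

lemma act_type_inv:
  assumes "c \<in> carrier C_group" "X \<in> iso_types"
  shows "act_type c (act_type (inv\<^bsub>C_group\<^esub> c) X) = X" "act_type (inv\<^bsub>C_group\<^esub> c) (act_type c X) = X"
  using assms by (auto simp: iso_types_type_of act_type_type_of act_inv)

lemma act_type_emb:
  assumes "c \<in> carrier C_group" "X \<in> iso_types" "Y \<in> iso_types"
  shows "act_type c X \<sqsubseteq>\<^sub>D act_type c Y \<longleftrightarrow> X \<sqsubseteq>\<^sub>D Y"
proof -
  have "embeds (act c G) (act c H) \<longleftrightarrow> embeds G H" if "G \<in> fin_digraphs" "H \<in> fin_digraphs" for G H
    using act_embeds[of G H c] act_embeds[of "act c G" "act c H" "inv\<^bsub>C_group\<^esub> c"] act_inv(2)[OF assms(1)] that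
    by auto
  then show ?thesis using assms by (auto simp: iso_types_type_of act_type_type_of emb_type_of)
qed

lemma act_type_first_levels:
  assumes "c \<in> carrier C_group" "X \<in> first_levels n iso_types"
  shows "act_type c X \<in> first_levels n iso_types"
  using assms by (auto simp: first_levels_iso_types act_type_type_of)

section \<open>Digraphs with few vertices\<close>

definition looped :: "nat pair_pre_digraph \<Rightarrow> nat \<Rightarrow> bool" where
  "looped H x \<longleftrightarrow> (x, x) \<in> parcs H"

definition arcs_of :: "nat pair_pre_digraph \<Rightarrow> nat \<Rightarrow> nat \<Rightarrow> bool \<times> bool" where
  "arcs_of H x y = ((x, y) \<in> parcs H, (y, x) \<in> parcs H)"

lemma arcs_of_swap: "arcs_of H x y = p \<longleftrightarrow> arcs_of H y x = prod.swap p"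
  by (cases p) (auto simp: arcs_of_def)

definition mat_graph :: "bool list list \<Rightarrow> nat pair_pre_digraph" where
  "mat_graph A = dg {..<length A} (\<lambda>i j. A ! i ! j)"

text \<open>In \<open>g3\<close>, the arguments \<open>p\<close>, \<open>q\<close>, \<open>s\<close> belong to the pairs 01, 12, 02; in \<open>g4\<close> they belong to 12, 23, 13.\<close>

definition g1 :: "bool \<Rightarrow> nat pair_pre_digraph" where
  "g1 a = mat_graph [[a]]"

definition g2 :: "bool \<Rightarrow> bool \<Rightarrow> bool \<times> bool \<Rightarrow> nat pair_pre_digraph" where
  "g2 a b p = mat_graph [[a, fst p], [snd p, b]]"

definition g3 :: "bool \<Rightarrow> bool \<Rightarrow> bool \<Rightarrow> bool \<times> bool \<Rightarrow> bool \<times> bool \<Rightarrow> bool \<times> bool \<Rightarrow> nat pair_pre_digraph" where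
  "g3 a b c p q s = mat_graph [[a, fst p, fst s], [snd p, b, fst q], [snd s, snd q, c]]"

definition g4 :: "bool \<Rightarrow> bool \<times> bool \<Rightarrow> bool \<times> bool \<Rightarrow> bool \<times> bool \<Rightarrow>
    bool \<times> bool \<Rightarrow> bool \<times> bool \<Rightarrow> bool \<times> bool \<Rightarrow> nat pair_pre_digraph" where
  "g4 b l m n p q s = mat_graph
     [[\<not> b, fst l, fst m, fst n], [snd l, b, fst p, fst s], [snd m, snd p, b, fst q], [snd n, snd s, snd q, b]]"

lemma fin_mat_graph [simp]: "mat_graph A \<in> fin_digraphs \<longleftrightarrow> A \<noteq> []"
  by (simp add: mat_graph_def lessThan_empty_iff)

lemma size_mat_graph [simp]: "size_of (mat_graph A) = length A"
  by (simp add: size_of_def mat_graph_def)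

lemma fin_g [simp]:
  "g1 a \<in> fin_digraphs" "g2 a b p \<in> fin_digraphs" "g3 a b c p q s \<in> fin_digraphs"
  "g4 a l m n p q s \<in> fin_digraphs"
  by (simp_all add: g1_def g2_def g3_def g4_def)

lemma size_g [simp]:
  "size_of (g1 a) = 1" "size_of (g2 a b p) = 2" "size_of (g3 a b c p q s) = 3"
  "size_of (g4 a l m n p q s) = 4"
  by (simp_all add: g1_def g2_def g3_def g4_def)

text \<open>An embedding is given by the list of its values. For a concrete matrix this unfolds into
  one quantifier per vertex, which yields the explicit criteria for \<open>g1\<close>,
  \<open>g2\<close> and \<open>g3\<close>.\<close>

lemma embeds_mat_graph:
  "embeds (mat_graph A) H \<longleftrightarrow> (\<exists>xs. length xs = length A \<and> distinct xs \<and> set xs \<subseteq> pverts H \<and>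
     (\<forall>i<length A. \<forall>j<length A. (xs ! i, xs ! j) \<in> parcs H \<longleftrightarrow> A ! i ! j))" (is "?L \<longleftrightarrow> ?R")
proof
  assume ?L
  then obtain f where f: "is_emb f (mat_graph A) H" by (auto simp: embeds_def)
  show ?R
    by (rule exI[of _ "map f [0..<length A]"])
       (use f in \<open>auto simp: is_emb_def mat_graph_def distinct_map atLeast0LessThan\<close>)
next
  assume ?R
  then obtain xs where xs: "length xs = length A" "distinct xs" "set xs \<subseteq> pverts H"
    "\<forall>i<length A. \<forall>j<length A. (xs ! i, xs ! j) \<in> parcs H \<longleftrightarrow> A ! i ! j" by blast
  then have "is_emb ((!) xs) (mat_graph A) H"
    by (auto simp: is_emb_def mat_graph_def inj_on_def nth_eq_iff_index_eq)
  then show ?L by (auto simp: embeds_def)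
qed

lemma ex_list_length:
  "(\<exists>xs. length xs = Suc n \<and> P xs) \<longleftrightarrow> (\<exists>x xs. length xs = n \<and> P (x # xs))"
  by (metis length_Suc_conv)

lemma embeds_g1: "embeds (g1 a) H \<longleftrightarrow> (\<exists>x\<in>pverts H. looped H x = a)"
  unfolding g1_def embeds_mat_graph
  by (simp add: ex_list_length looped_def) blast

lemma embeds_g2:
  "embeds (g2 a b p) H \<longleftrightarrow> (\<exists>x\<in>pverts H. \<exists>y\<in>pverts H. x \<noteq> y \<and>
     looped H x = a \<and> looped H y = b \<and> arcs_of H x y = p)"
  unfolding g2_def embeds_mat_graph
  by (simp add: ex_list_length less_Suc_eq all_conj_distrib looped_def arcs_of_def prod_eq_iff) blast

lemma embeds_g3:
  "embeds (g3 a b c p q s) H \<longleftrightarrow> (\<exists>x\<in>pverts H. \<exists>y\<in>pverts H. \<exists>z\<in>pverts H.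
     x \<noteq> y \<and> y \<noteq> z \<and> x \<noteq> z \<and> looped H x = a \<and> looped H y = b \<and> looped H z = c \<and>
     arcs_of H x y = p \<and> arcs_of H y z = q \<and> arcs_of H x z = s)"
  unfolding g3_def embeds_mat_graph
  by (simp add: ex_list_length less_Suc_eq all_conj_distrib looped_def arcs_of_def prod_eq_iff) blast

lemma pverts_g: "pverts (g1 a) = {0}" "pverts (g2 a b p) = {0, 1}" "pverts (g3 a b c p q s) = {0, 1, 2}"
  "pverts (g4 b l m n p q s) = {0, 1, 2, 3}"
  by (auto simp: g1_def g2_def g3_def g4_def mat_graph_def)

lemma looped_g:
  "looped (g1 a) 0 = a"
  "looped (g2 a b p) 0 = a" "looped (g2 a b p) (Suc 0) = b"
  "looped (g3 a b c p q s) 0 = a" "looped (g3 a b c p q s) (Suc 0) = b" "looped (g3 a b c p q s) 2 = c"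
  "looped (g4 b l m n p q s) 0 = (\<not> b)" "looped (g4 b l m n p q s) (Suc 0) = b"
  "looped (g4 b l m n p q s) 2 = b" "looped (g4 b l m n p q s) 3 = b"
  by (auto simp: g1_def g2_def g3_def g4_def mat_graph_def looped_def)

lemma arcs_of_g:
  "arcs_of (g2 a b p) 0 (Suc 0) = p" "arcs_of (g2 a b p) (Suc 0) 0 = prod.swap p"
  "arcs_of (g3 a b c p q s) 0 (Suc 0) = p" "arcs_of (g3 a b c p q s) (Suc 0) 2 = q"
  "arcs_of (g3 a b c p q s) 0 2 = s" "arcs_of (g3 a b c p q s) (Suc 0) 0 = prod.swap p"
  "arcs_of (g3 a b c p q s) 2 (Suc 0) = prod.swap q" "arcs_of (g3 a b c p q s) 2 0 = prod.swap s"
  "arcs_of (g4 b l m n p q s) 0 (Suc 0) = l" "arcs_of (g4 b l m n p q s) 0 2 = m"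
  "arcs_of (g4 b l m n p q s) 0 3 = n"
  "arcs_of (g4 b l m n p q s) (Suc 0) 2 = p" "arcs_of (g4 b l m n p q s) 2 3 = q"
  "arcs_of (g4 b l m n p q s) (Suc 0) 3 = s"
  "arcs_of (g4 b l m n p q s) (Suc 0) 0 = prod.swap l" "arcs_of (g4 b l m n p q s) 2 0 = prod.swap m"
  "arcs_of (g4 b l m n p q s) 3 0 = prod.swap n"
  "arcs_of (g4 b l m n p q s) 2 (Suc 0) = prod.swap p" "arcs_of (g4 b l m n p q s) 3 2 = prod.swap q"
  "arcs_of (g4 b l m n p q s) 3 (Suc 0) = prod.swap s"
  by (auto simp: g2_def g3_def g4_def mat_graph_def arcs_of_def prod_eq_iff)

lemmas g_simps = pverts_g looped_g arcs_of_g

section \<open>Normal forms of digraphs with at most three vertices\<close>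

lemma exhaust_size1:
  assumes "G \<in> fin_digraphs" "size_of G = 1"
  obtains a where "type_of G = type_of (g1 a)"
proof -
  obtain x where "pverts G = {x}" using assms(2) by (auto simp: size_of_def card_1_singleton_iff)
  then have "embeds (g1 (looped G x)) G" by (auto simp: embeds_g1)
  then have "type_of (g1 (looped G x)) = type_of G"
    using assms by (intro type_of_embedsI) auto
  then show ?thesis using that by metis
qed

lemma exhaust_size2:
  assumes "G \<in> fin_digraphs" "size_of G = 2"
  obtains a b p where "type_of G = type_of (g2 a b p)"
proof -
  obtain x y where "pverts G = {x, y}" "x \<noteq> y"
    using assms(2) by (auto simp: size_of_def card_2_iff)
  then have "embeds (g2 (looped G x) (looped G y) (arcs_of G x y)) G" by (auto simp: embeds_g2)
  then have "type_of (g2 (looped G x) (looped G y) (arcs_of G x y)) = type_of G"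
    using assms by (intro type_of_embedsI) auto
  then show ?thesis using that by metis
qed

text \<open>Every enumeration of the three vertices gives a normal form; a second enumeration of the
  same digraph yields the symmetries between normal forms.\<close>

lemma type_of_g3I:
  assumes "G \<in> fin_digraphs" "size_of G = 3" "x \<in> pverts G" "y \<in> pverts G" "z \<in> pverts G"
    "x \<noteq> y" "y \<noteq> z" "x \<noteq> z"
  shows "type_of G = type_of (g3 (looped G x) (looped G y) (looped G z)
           (arcs_of G x y) (arcs_of G y z) (arcs_of G x z))"
proof -
  have "embeds (g3 (looped G x) (looped G y) (looped G z)
           (arcs_of G x y) (arcs_of G y z) (arcs_of G x z)) G"
    unfolding embeds_g3 using assms by blast
  then show ?thesis
    using assms by (intro type_of_embedsI[symmetric]) auto
qed

text \<open>If the loops are not all alike, one of the three vertices differs from the other two and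
  is listed first.\<close>

lemma exhaust_size3:
  assumes G: "G \<in> fin_digraphs" "size_of G = 3"
  obtains (mono) b p q s where "type_of G = type_of (g3 b b b p q s)"
    | (mixed) b l p m where "type_of G = type_of (g3 (\<not> b) b b l p m)"
proof -
  obtain x y z where V: "pverts G = {x, y, z}" "x \<noteq> y" "y \<noteq> z" "x \<noteq> z"
    using assms(2) by (auto simp: size_of_def card_3_iff)
  note I = type_of_g3I[OF G]
  consider "looped G y = looped G x" "looped G z = looped G x"
    | "looped G z = looped G y" "looped G x = (\<not> looped G y)"
    | "looped G z = looped G x" "looped G y = (\<not> looped G x)"
    | "looped G y = looped G x" "looped G z = (\<not> looped G x)" by blast
  then show ?thesis
  proof cases
    case 1 then show ?thesis using I[of x y z] V mono by auto
  next
    case 2 then show ?thesis using I[of x y z] V mixed by auto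
  next
    case 3 then show ?thesis using I[of y x z] V mixed by auto
  next
    case 4 then show ?thesis using I[of z x y] V mixed by auto
  qed
qed

section \<open>The action and isomorphism in terms of normal forms\<close>

definition act_pair :: "base_elem \<times> int \<Rightarrow> bool \<Rightarrow> bool \<Rightarrow> bool \<times> bool \<Rightarrow> bool \<times> bool" where
  "act_pair c a b p =
     (new_arc (fst c) (a \<noteq> (snd c = 1)) (b \<noteq> (snd c = 1)) (fst p) (snd p),
      new_arc (fst c) (b \<noteq> (snd c = 1)) (a \<noteq> (snd c = 1)) (snd p) (fst p))"

lemma act_mat:
  "act c (g1 a) = g1 (a \<noteq> (snd c = 1))"
  "act c (g2 a b p) = g2 (a \<noteq> (snd c = 1)) (b \<noteq> (snd c = 1)) (act_pair c a b p)"
  "act c (g3 a b d p q s) = g3 (a \<noteq> (snd c = 1)) (b \<noteq> (snd c = 1)) (d \<noteq> (snd c = 1))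
     (act_pair c a b p) (act_pair c b d q) (act_pair c a d s)"
proof -
  show "act c (g1 a) = g1 (a \<noteq> (snd c = 1))"
    by (rule digraph_eqI, simp, simp) (auto simp: g1_def mat_graph_def arc_act)
  show "act c (g2 a b p) = g2 (a \<noteq> (snd c = 1)) (b \<noteq> (snd c = 1)) (act_pair c a b p)"
    by (rule digraph_eqI, simp, simp)
       (auto simp: g2_def mat_graph_def act_pair_def arc_act less_Suc_eq)
  show "act c (g3 a b d p q s) = g3 (a \<noteq> (snd c = 1)) (b \<noteq> (snd c = 1)) (d \<noteq> (snd c = 1))
     (act_pair c a b p) (act_pair c b d q) (act_pair c a d s)"
    by (rule digraph_eqI, simp, simp)
       (auto simp: g3_def mat_graph_def act_pair_def arc_act less_Suc_eq)
qed

lemma type_of_g1_eq [simp]: "type_of (g1 a) = type_of (g1 b) \<longleftrightarrow> a = b"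
  by (subst type_of_eq_iff) (auto simp: embeds_g1 g_simps)

lemma type_of_g2_eq:
  "type_of (g2 a b p) = type_of (g2 c d q) \<longleftrightarrow> (a = c \<and> b = d \<and> p = q) \<or> (a = d \<and> b = c \<and> prod.swap p = q)"
  by (subst type_of_eq_iff) (auto simp: embeds_g2 g_simps)

text \<open>An isomorphism has to preserve the vertex whose loop differs, so only the exchange of
  the other two is left.\<close>

lemma type_of_mixed_eq:
  "type_of (g3 (\<not> b) b b l p m) = type_of (g3 (\<not> b) b b l' p' m') \<longleftrightarrow>
     (l = l' \<and> p = p' \<and> m = m') \<or> (l = m' \<and> m = l' \<and> prod.swap p = p')"
  by (subst type_of_eq_iff) (auto simp: embeds_g3 g_simps)

section \<open>Automorphisms preserve the number of vertices\<close>

abbreviation levels :: "nat \<Rightarrow> iso_type set" where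
  "levels n \<equiv> first_levels n iso_types"

text \<open>In contrast to \<open>order_auts\<close>, nothing is asked outside \<open>P\<close>, so
  one map can be studied on several sets of levels without being restricted each time.\<close>

definition is_aut :: "iso_type set \<Rightarrow> (iso_type \<Rightarrow> iso_type) \<Rightarrow> bool" where
  "is_aut P \<phi> \<longleftrightarrow> bij_betw \<phi> P P \<and> (\<forall>X\<in>P. \<forall>Y\<in>P. \<phi> X \<sqsubseteq>\<^sub>D \<phi> Y \<longleftrightarrow> X \<sqsubseteq>\<^sub>D Y)"

text \<open>A common setting for the whole poset and for its first \<open>n\<close> levels, in which
  the number of vertices can be recovered from the order.\<close>

definition down_closed :: "iso_type set \<Rightarrow> bool" where
  "down_closed P \<longleftrightarrow> P \<subseteq> iso_types \<and> (\<forall>X\<in>P. \<forall>Y\<in>iso_types. Y \<sqsubseteq>\<^sub>D X \<longrightarrow> Y \<in> P)"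

lemma order_auts_iff: "\<phi> \<in> order_auts P (\<sqsubseteq>\<^sub>D) \<longleftrightarrow> is_aut P \<phi> \<and> \<phi> \<in> extensional P"
  by (auto simp: order_auts_def is_aut_def Bij_def)

lemma is_aut_inv:
  assumes "is_aut P \<phi>" shows "is_aut P (inv_into P \<phi>)"
proof -
  have bij: "bij_betw \<phi> P P" using assms by (simp add: is_aut_def)
  have "inv_into P \<phi> X \<sqsubseteq>\<^sub>D inv_into P \<phi> Y \<longleftrightarrow> X \<sqsubseteq>\<^sub>D Y" if "X \<in> P" "Y \<in> P" for X Y
  proof -
    have "inv_into P \<phi> X \<in> P" "inv_into P \<phi> Y \<in> P"
      using that bij by (metis bij_betw_def inv_into_into)+
    then show ?thesis
      using assms that bij by (metis bij_betw_inv_into_right is_aut_def)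
  qed
  then show ?thesis using bij_betw_inv_into[OF bij] by (simp add: is_aut_def)
qed

lemma is_aut_comp: "is_aut P \<phi> \<Longrightarrow> is_aut P \<psi> \<Longrightarrow> is_aut P (\<phi> \<circ> \<psi>)"
  unfolding is_aut_def by (auto intro: bij_betw_trans dest: bij_betwE)

lemma is_aut_act_type:
  assumes c: "c \<in> carrier C_group" shows "is_aut iso_types (act_type c)" "is_aut (levels n) (act_type c)"
proof -
  have *: "is_aut P (act_type c)"
    if P: "P \<subseteq> iso_types" "\<And>d. d \<in> carrier C_group \<Longrightarrow> act_type d ` P \<subseteq> P" for P
    unfolding is_aut_def
  proof
    have cl: "act_type d X \<in> P" if "d \<in> carrier C_group" "X \<in> P" for d X
      using P(2)[OF that(1)] that(2) by (rule subsetD[OF _ imageI])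
    have i: "inv\<^bsub>C_group\<^esub> c \<in> carrier C_group" using c by simp
    show "bij_betw (act_type c) P P"
      by (rule bij_betw_byWitness[where f' = "act_type (inv\<^bsub>C_group\<^esub> c)"])
         (auto simp: act_type_inv[OF c] subsetD[OF P(1)] cl c i)
    show "\<forall>X\<in>P. \<forall>Y\<in>P. act_type c X \<sqsubseteq>\<^sub>D act_type c Y \<longleftrightarrow> X \<sqsubseteq>\<^sub>D Y"
      using act_type_emb[OF c] P(1) by (meson subsetD)
  qed
  show "is_aut iso_types (act_type c)"
    by (rule *) (auto simp: iso_types_type_of act_type_type_of)
  show "is_aut (levels n) (act_type c)"
  proof (rule *)
    show "levels n \<subseteq> iso_types" by (auto simp: first_levels_def)
  qed (use act_type_first_levels in blast)
qed

lemma down_closed_iso_types: "down_closed iso_types"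
  by (simp add: down_closed_def)

lemma down_closed_levels: "down_closed (levels n)"
  unfolding down_closed_def
proof (intro conjI ballI impI)
  fix X Y assume "X \<in> levels n" "Y \<in> iso_types" "Y \<sqsubseteq>\<^sub>D X"
  then obtain G H where "G \<in> fin_digraphs" "size_of G \<le> n" "X = type_of G"
    "H \<in> fin_digraphs" "Y = type_of H"
    by (auto simp: first_levels_iso_types) (auto simp: iso_types_type_of)
  then show "Y \<in> levels n"
    using \<open>Y \<sqsubseteq>\<^sub>D X\<close> embeds_size[of H G] by (simp add: emb_type_of)
qed (simp add: first_levels_def)

text \<open>Delete a vertex; \<open>0 < n\<close> keeps the remaining vertex set nonempty.\<close>

lemma exists_embeds_pred:
  assumes G: "G \<in> fin_digraphs" "size_of G = Suc n" and "0 < n"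
  shows "\<exists>K\<in>fin_digraphs. embeds K G \<and> size_of K = n"
proof -
  obtain x where x: "x \<in> pverts G" using G by (auto simp: fin_digraphs_iff)
  define K where "K = dg (pverts G - {x}) (\<lambda>x y. (x, y) \<in> parcs G)"
  have n: "card (pverts G - {x}) = n" using x G by (simp add: size_of_def)
  then have "pverts G - {x} \<noteq> {}" using assms(3) by (metis card.empty less_irrefl)
  then have "K \<in> fin_digraphs" using G by (auto simp: K_def fin_digraphs_iff)
  moreover have "is_emb id K G" by (auto simp: is_emb_def K_def)
  moreover have "size_of K = n" using n by (simp add: size_of_def K_def)
  ultimately show ?thesis unfolding embeds_def by blast
qed

text \<open>The number of vertices of \<open>G\<close> is the length of a longest chain below it.\<close>

lemma aut_size_le:
  assumes P: "down_closed P" and aut: "is_aut P \<phi>"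
  shows "G \<in> fin_digraphs \<Longrightarrow> H \<in> fin_digraphs \<Longrightarrow> type_of G \<in> P \<Longrightarrow> \<phi> (type_of G) = type_of H \<Longrightarrow>
    size_of G \<le> size_of H"
proof (induction "size_of G" arbitrary: G H)
  case 0
  then show ?case by simp
next
  case (Suc n)
  show ?case
  proof (cases "n = 0")
    case True
    then show ?thesis using Suc size_of_pos[of H] by simp
  next
    case False
    then obtain K where K: "K \<in> fin_digraphs" "embeds K G" "size_of K = n"
      using exists_embeds_pred[of G n] Suc by auto
    then have below: "type_of K \<sqsubseteq>\<^sub>D type_of G" using Suc by (simp add: emb_type_of)
    then have KP: "type_of K \<in> P" using P Suc K by (auto simp: down_closed_def)
    then have "\<phi> (type_of K) \<in> P" using aut by (auto simp: is_aut_def dest: bij_betwE)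
    then obtain L where L: "L \<in> fin_digraphs" "\<phi> (type_of K) = type_of L"
      using P by (auto simp: down_closed_def iso_types_type_of)
    have "n \<le> size_of L" using Suc.hyps(1)[of K L] K KP L by auto
    moreover have LH: "embeds L H"
    proof -
      have "\<phi> (type_of K) \<sqsubseteq>\<^sub>D \<phi> (type_of G)"
        using aut KP Suc.prems(3) below by (simp add: is_aut_def)
      then show ?thesis using L Suc.prems by (simp add: emb_type_of)
    qed
    \<comment> \<open>Injectivity keeps the step from \<open>K\<close> to \<open>G\<close> strict in
      the image, which supplies the additional vertex.\<close>
    moreover have "type_of L \<noteq> type_of H"
    proof
      assume "type_of L = type_of H"
      then have "\<phi> (type_of K) = \<phi> (type_of G)" using Suc.prems L by simp
      moreover have "inj_on \<phi> P" using aut by (simp add: is_aut_def bij_betw_def)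
      ultimately have "type_of K = type_of G"
        using KP Suc.prems(3) by (simp add: inj_on_eq_iff)
      then show False using K Suc.hyps Suc.prems type_of_eq_iff[of K G] by simp
    qed
    then have "size_of L \<noteq> size_of H" using LH type_of_eq_iff L(1) Suc.prems(2) by blast
    then have "size_of L < size_of H" using embeds_size[OF LH] Suc.prems by simp
    ultimately show ?thesis using Suc.hyps(2) by linarith
  qed
qed

text \<open>The reverse inequality is \<open>aut_size_le\<close> for the inverse
  automorphism.\<close>

lemma aut_size:
  assumes P: "down_closed P" and aut: "is_aut P \<phi>" and G: "G \<in> fin_digraphs" and H: "H \<in> fin_digraphs"
    and GP: "type_of G \<in> P" and GH: "\<phi> (type_of G) = type_of H"
  shows "size_of H = size_of G"
proof -
  have bij: "bij_betw \<phi> P P" using aut by (simp add: is_aut_def)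
  then have "type_of H \<in> P" using GP GH by (metis bij_betwE)
  moreover have "inv_into P \<phi> (type_of H) = type_of G"
    using bij_betw_inv_into_left[OF bij GP] GH by simp
  ultimately show ?thesis
    using aut_size_le[OF P aut G H GP GH] aut_size_le[OF P is_aut_inv[OF aut] H G] by simp
qed

text \<open>Since \<phi> and its inverse preserve the number of vertices, both map the first levels
  into themselves.\<close>

lemma is_aut_first_levels:
  assumes P: "down_closed P" and aut: "is_aut P \<phi>"
  shows "is_aut (first_levels n P) \<phi>"
proof -
  have PD: "P \<subseteq> iso_types" using P by (simp add: down_closed_def)
  have sub: "first_levels n P \<subseteq> P" by (auto simp: first_levels_def)
  have *: "\<psi> ` first_levels n P \<subseteq> first_levels n P" if aut: "is_aut P \<psi>" for \<psi>
  proof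
    fix Y assume "Y \<in> \<psi> ` first_levels n P"
    then obtain X where X: "X \<in> first_levels n P" "Y = \<psi> X" by blast
    then have XY: "X \<in> P" "Y \<in> P" using sub aut by (auto simp: is_aut_def dest: bij_betwE)
    then obtain G H where GH: "G \<in> fin_digraphs" "H \<in> fin_digraphs" "X = type_of G" "Y = type_of H"
      using PD unfolding iso_types_type_of by blast
    have "size_of H = size_of G" using aut_size[OF P aut, of G H] GH X XY by simp
    then show "Y \<in> first_levels n P" using X XY GH type_of_in_first_levels by metis
  qed
  have bij: "bij_betw \<phi> P P" using aut by (simp add: is_aut_def)
  have "bij_betw \<phi> (first_levels n P) (first_levels n P)"
  proof (rule bij_betw_byWitness[where f' = "inv_into P \<phi>"])
    show "\<forall>X\<in>first_levels n P. inv_into P \<phi> (\<phi> X) = X"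
      using sub bij_betw_inv_into_left[OF bij] by blast
    show "\<forall>X\<in>first_levels n P. \<phi> (inv_into P \<phi> X) = X"
      using sub bij_betw_inv_into_right[OF bij] by blast
  qed (use *[OF aut] *[OF is_aut_inv[OF aut]] in blast)+
  then show ?thesis using aut sub by (auto simp: is_aut_def)
qed

section \<open>Automorphisms of the first four levels\<close>

locale level4_aut =
  fixes \<phi> :: "iso_type \<Rightarrow> iso_type"
  assumes aut: "is_aut (levels 4) \<phi>"
begin

lemma image_type:
  assumes "G \<in> fin_digraphs" "size_of G \<le> 4"
  obtains H where "H \<in> fin_digraphs" "size_of H = size_of G" "\<phi> (type_of G) = type_of H"
proof -
  have "\<phi> (type_of G) \<in> levels 4" using aut assms by (auto simp: is_aut_def dest: bij_betwE)
  then obtain H where H: "H \<in> fin_digraphs" "\<phi> (type_of G) = type_of H"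
    by (auto simp: first_levels_iso_types)
  then have "size_of H = size_of G" using aut_size[OF down_closed_levels aut, of G H] assms by simp
  then show ?thesis using that H by blast
qed

lemma preimage_type:
  assumes "H \<in> fin_digraphs" "size_of H \<le> 4"
  obtains G where "G \<in> fin_digraphs" "size_of G = size_of H" "\<phi> (type_of G) = type_of H"
proof -
  have "type_of H \<in> \<phi> ` levels 4" using aut assms by (auto simp: is_aut_def bij_betw_def)
  then obtain X where "X \<in> levels 4" "\<phi> X = type_of H" by auto
  then obtain G where G: "G \<in> fin_digraphs" "\<phi> (type_of G) = type_of H" "size_of G \<le> 4"
    by (auto simp: first_levels_iso_types)
  then have "size_of H = size_of G" using aut_size[OF down_closed_levels aut, of G H] assms by simp
  then show ?thesis using that G by metis
qed

lemma embeds_image: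
  assumes "K \<in> fin_digraphs" "size_of K \<le> 4" "G \<in> fin_digraphs" "size_of G \<le> 4"
    and "K' \<in> fin_digraphs" "G' \<in> fin_digraphs"
    and "\<phi> (type_of K) = type_of K'" "\<phi> (type_of G) = type_of G'"
  shows "embeds K' G' \<longleftrightarrow> embeds K G"
proof -
  have "type_of K \<in> levels 4" "type_of G \<in> levels 4" using assms by auto
  then have "\<phi> (type_of K) \<sqsubseteq>\<^sub>D \<phi> (type_of G) \<longleftrightarrow> type_of K \<sqsubseteq>\<^sub>D type_of G"
    using aut by (simp add: is_aut_def)
  then show ?thesis using assms by (simp add: emb_type_of)
qed

lemma inj_type:
  assumes "G \<in> fin_digraphs" "size_of G \<le> 4" "K \<in> fin_digraphs" "size_of K \<le> 4"
  shows "\<phi> (type_of G) = \<phi> (type_of K) \<longleftrightarrow> type_of G = type_of K"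
proof -
  have "inj_on \<phi> (levels 4)" using aut by (simp add: is_aut_def bij_betw_def)
  then show ?thesis using assms by (simp add: inj_on_eq_iff)
qed

end

lemma level4_aut_act:
  assumes "c \<in> carrier C_group" "level4_aut \<phi>" shows "level4_aut (act_type c \<circ> \<phi>)"
  using assms is_aut_comp[OF is_aut_act_type(2)] by (auto simp: level4_aut_def)

definition agrees_with_C :: "(iso_type \<Rightarrow> iso_type) \<Rightarrow> bool" where
  "agrees_with_C \<phi> \<longleftrightarrow> (\<exists>c\<in>carrier C_group. \<forall>X\<in>levels 3. \<phi> X = act_type c X)"

text \<open>Justifies normalizing \<phi>: composition with a member of the group is undone by its
  inverse, so it suffices to treat the composite.\<close>

lemma agrees_with_C_act:
  assumes c: "c \<in> carrier C_group" and "level4_aut \<phi>" and "agrees_with_C (act_type c \<circ> \<phi>)"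
  shows "agrees_with_C \<phi>"
proof -
  obtain d where d: "d \<in> carrier C_group" "\<forall>X\<in>levels 3. act_type c (\<phi> X) = act_type d X"
    using assms(3) by (auto simp: agrees_with_C_def)
  have "\<phi> X = act_type (inv\<^bsub>C_group\<^esub> c \<otimes>\<^bsub>C_group\<^esub> d) X" if X: "X \<in> levels 3" for X
  proof -
    have "X \<in> iso_types" using X by (simp add: first_levels_def)
    have "X \<in> levels 4" using X by (auto simp: first_levels_iso_types)
    then have "\<phi> X \<in> levels 4" using assms(2) by (auto simp: level4_aut_def is_aut_def dest: bij_betwE)
    then have "\<phi> X \<in> iso_types" by (simp add: first_levels_def)
    then have "\<phi> X = act_type (inv\<^bsub>C_group\<^esub> c) (act_type c (\<phi> X))" using act_type_inv c by simp
    then show ?thesis using d X act_type_mult[OF _ d(1) \<open>X \<in> iso_types\<close>] c by simp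
  qed
  then show ?thesis using c d by (auto simp: agrees_with_C_def)
qed

section \<open>Two vertices\<close>

locale level4_aut1 = level4_aut +
  assumes fix1: "\<phi> (type_of (g1 a)) = type_of (g1 a)"
begin

text \<open>The one-vertex types, being fixed, detect which kinds of vertices occur.\<close>

lemma loops_image:
  assumes "G \<in> fin_digraphs" "size_of G \<le> 4" "H \<in> fin_digraphs" "\<phi> (type_of G) = type_of H"
  shows "(\<exists>x\<in>pverts H. looped H x = a) \<longleftrightarrow> (\<exists>x\<in>pverts G. looped G x = a)"
  using embeds_image[OF _ _ assms(1,2) _ assms(3) fix1 assms(4)] by (simp add: embeds_g1)

text \<open>The set of loop marks is preserved, and on two vertices this set determines the marks up
  to the order of the vertices.\<close>

lemma image_g2: "\<exists>p'. \<phi> (type_of (g2 a b p)) = type_of (g2 a b p')"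
proof -
  obtain H where H: "H \<in> fin_digraphs" "size_of H = 2" "\<phi> (type_of (g2 a b p)) = type_of H"
    using image_type[of "g2 a b p"] by auto
  obtain a' b' p' where *: "type_of H = type_of (g2 a' b' p')" using H exhaust_size2 by blast
  have "x = a' \<or> x = b' \<longleftrightarrow> x = a \<or> x = b" for x
    using loops_image[of "g2 a b p" "g2 a' b' p'" x] H * by (auto simp: g_simps)
  then have "a' = a \<and> b' = b \<or> a' = b \<and> b' = a" by metis
  then show ?thesis
    using H * by (metis type_of_g2_eq)
qed

text \<open>Both the cyclic and the transitive tournament have only single arcs below them, whereas there
  is just one digraph on three vertices all of whose pairs are a given symmetric one.\<close>

lemma image_single: "\<phi> (type_of (g2 b b (True, False))) = type_of (g2 b b (True, False))"
proof (rule ccontr)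
  assume neg: "\<not> ?thesis"
  obtain p' where p': "\<phi> (type_of (g2 b b (True, False))) = type_of (g2 b b p')" using image_g2 by blast
  \<comment> \<open>A \<open>p'\<close> that is not symmetric would be a single arc, and both
    orientations give the same type.\<close>
  then have sym: "prod.swap p' = p'" using neg by (cases p') (auto simp: type_of_g2_eq)
  have *: "\<phi> (type_of (g3 b b b s t u)) = type_of (g3 b b b p' p' p')"
    if single: "{s, t, u} \<subseteq> {(True, False), (False, True)}" for s t u
  proof -
    let ?T = "g3 b b b s t u"
    obtain H where H: "H \<in> fin_digraphs" "size_of H = 3" "\<phi> (type_of ?T) = type_of H"
      using image_type[of ?T] by auto
    have loop: "looped H x = b" if "x \<in> pverts H" for x
      using loops_image[of ?T H "\<not> b"] H that by (auto simp: g_simps)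
    \<comment> \<open>Each pair of \<open>H\<close> is pulled back along \<phi> to a pair below the
      tournament, hence to a single arc.\<close>
    have arc: "arcs_of H x y = p'" if "x \<in> pverts H" "y \<in> pverts H" "x \<noteq> y" for x y
    proof -
      let ?K = "g2 b b (arcs_of H x y)"
      obtain K where K: "K \<in> fin_digraphs" "size_of K = 2" "\<phi> (type_of K) = type_of ?K"
        using preimage_type[of ?K] by auto
      obtain a' b' p0 where K0: "type_of K = type_of (g2 a' b' p0)" using K exhaust_size2 by blast
      have "embeds ?K H" using that loop by (auto simp: embeds_g2)
      then have "embeds (g2 a' b' p0) ?T"
        using embeds_image[of "g2 a' b' p0" ?T ?K H] K K0 H by simp
      then have "a' = b" "b' = b" "p0 = (True, False) \<or> p0 = (False, True)"
        using single by (auto simp: embeds_g2 g_simps)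
      then have "type_of K = type_of (g2 b b (True, False))"
        unfolding K0 by (auto simp: type_of_g2_eq)
      then have "type_of (g2 b b p') = type_of ?K" using K(3) p' by simp
      then show ?thesis using sym by (auto simp: type_of_g2_eq)
    qed
    obtain x y z where V: "pverts H = {x, y, z}" "x \<noteq> y" "y \<noteq> z" "x \<noteq> z"
      using H(2) by (auto simp: size_of_def card_3_iff)
    then show ?thesis using type_of_g3I[of H x y z] H loop arc by simp
  qed
  let ?C = "g3 b b b (True, False) (True, False) (False, True)"
    and ?T = "g3 b b b (True, False) (True, False) (True, False)"
  have "type_of ?C = type_of ?T" using inj_type[of ?C ?T] * by simp
  then have "embeds ?C ?T" by (simp add: type_of_eq_iff)
  then show False by (auto simp: embeds_g3 g_simps)
qed

text \<open>The single arc is fixed, so by injectivity the empty and the full pair are permuted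
  among themselves; \<open>e\<close> tells whether they are exchanged.\<close>

lemma image_sym: "\<exists>e. \<forall>x. \<phi> (type_of (g2 b b (x, x))) = type_of (g2 b b (x \<noteq> e, x \<noteq> e))"
proof -
  have "\<exists>y. \<phi> (type_of (g2 b b (x, x))) = type_of (g2 b b (y, y))" for x
  proof -
    obtain p' where p': "\<phi> (type_of (g2 b b (x, x))) = type_of (g2 b b p')" using image_g2 by blast
    have "type_of (g2 b b p') \<noteq> type_of (g2 b b (True, False))"
      using inj_type[of "g2 b b (x, x)" "g2 b b (True, False)"] image_single p'
      by (auto simp: type_of_g2_eq)
    then have "p' = (fst p', fst p')" by (cases p') (auto simp: type_of_g2_eq)
    then show ?thesis using p' by metis
  qed
  then obtain f where f: "\<And>x. \<phi> (type_of (g2 b b (x, x))) = type_of (g2 b b (f x, f x))" by metis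
  have "f True \<noteq> f False"
    using inj_type[of "g2 b b (True, True)" "g2 b b (False, False)"] f by (auto simp: type_of_g2_eq)
  then have eq: "f x = (x \<noteq> f False)" for x by (cases x) auto
  have "\<phi> (type_of (g2 b b (x, x))) = type_of (g2 b b (x \<noteq> f False, x \<noteq> f False))" for x
    using f[of x] unfolding eq[of x] .
  then show ?thesis by blast
qed

text \<open>The loops tell the two vertices apart, so the type determines \<open>p\<close>; thus an
  injective, hence bijective, map of the four states arises.\<close>

lemma image_loop_nonloop:
  "\<exists>\<sigma>. bij \<sigma> \<and> (\<forall>p. \<phi> (type_of (g2 True False p)) = type_of (g2 True False (\<sigma> p)))"
proof -
  obtain \<sigma> where \<sigma>: "\<And>p. \<phi> (type_of (g2 True False p)) = type_of (g2 True False (\<sigma> p))"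
    using image_g2 by metis
  have "inj \<sigma>"
  proof (rule injI)
    fix p q assume "\<sigma> p = \<sigma> q"
    then show "p = q"
      using \<sigma> inj_type[of "g2 True False p" "g2 True False q"] by (auto simp: type_of_g2_eq)
  qed
  then have "bij \<sigma>" by (simp add: bij_def finite_UNIV_inj_surj)
  then show ?thesis using \<sigma> by blast
qed

end

section \<open>Normalization on one and two vertices\<close>

lemma normalize_vertices:
  assumes "level4_aut \<phi>"
  shows "\<exists>c\<in>carrier C_group. level4_aut1 (act_type c \<circ> \<phi>)"
proof -
  interpret level4_aut \<phi> by fact
  have "\<exists>a'. \<phi> (type_of (g1 a)) = type_of (g1 a')" for a
  proof -
    obtain H where "H \<in> fin_digraphs" "size_of H = 1" "\<phi> (type_of (g1 a)) = type_of H"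
      using image_type[of "g1 a"] by auto
    then show ?thesis by (metis exhaust_size1)
  qed
  then obtain f where f: "\<And>a. \<phi> (type_of (g1 a)) = type_of (g1 (f a))" by metis
  have ne: "f True \<noteq> f False" using inj_type[of "g1 True" "g1 False"] f by simp
  define c :: "base_elem \<times> int" where "c = ((0, 0, 0, 0, id), if f False then 1 else 0)"
  have c: "c \<in> carrier C_group" by (simp add: c_def carrier_C_group carrier_base_group)
  have "act_type c (\<phi> (type_of (g1 a))) = type_of (g1 a)" for a
    using c ne by (cases a) (auto simp: f act_type_type_of act_mat c_def)
  then have "level4_aut1 (act_type c \<circ> \<phi>)"
    using level4_aut_act[OF c assms] by (simp add: level4_aut1_def level4_aut1_axioms_def)
  then show ?thesis using c by blast
qed

locale level4_aut2 = level4_aut1 +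
  assumes fix2: "\<phi> (type_of (g2 a b p)) = type_of (g2 a b p)"

lemma normalize_pairs:
  assumes "level4_aut1 \<phi>"
  shows "\<exists>c\<in>carrier C_group. level4_aut2 (act_type c \<circ> \<phi>)"
proof -
  interpret level4_aut1 \<phi> by fact
  obtain e where e: "\<And>b x. \<phi> (type_of (g2 b b (x, x))) = type_of (g2 b b (x \<noteq> e b, x \<noteq> e b))"
    using image_sym by metis
  obtain \<sigma> where \<sigma>: "bij \<sigma>" "\<And>p. \<phi> (type_of (g2 True False p)) = type_of (g2 True False (\<sigma> p))"
    using image_loop_nonloop by blast
  define enc' where "enc' = (\<lambda>p. enc (fst p) (snd p))"
  define dec' where "dec' = (\<lambda>l. (dec1 l, dec2 l))"
  have ed: "enc' (dec' l) = l" "dec' (enc' p) = p" for l p by (simp_all add: enc'_def dec'_def)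
  have bij: "bij enc'" "bij dec'" by (rule bij_betw_byWitness[where f' = dec'] bij_betw_byWitness[where f' = enc']; simp add: ed)+
  define \<pi> where "\<pi> = enc' \<circ> inv_into UNIV \<sigma> \<circ> dec'"
  have \<pi>: "bij \<pi>" unfolding \<pi>_def by (intro bij_comp bij bij_imp_bij_inv \<sigma>(1))
  \<comment> \<open>The first two entries undo the exchanges of empty and full pairs, and \<pi>
    undoes \<sigma>. The entries for reversing arcs between like vertices stay 0, as such a reversal
    is invisible on two vertices.\<close>
  define c :: "base_elem \<times> int" where
    "c = ((if e False then 1 else 0, if e True then 1 else 0, 0, 0, \<pi>), 0)"
  have c: "c \<in> carrier C_group" using \<pi> by (simp add: c_def carrier_C_group carrier_base_group)
  have k: "snd c \<noteq> 1" by (simp add: c_def)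
  have g1: "act_type c (\<phi> (type_of (g1 a))) = type_of (g1 a)" for a
    by (simp add: fix1 act_type_type_of[OF c] act_mat k)
  have loop: "act_type c (\<phi> (type_of (g2 True False p))) = type_of (g2 True False p)" for p
  proof -
    have "\<pi> (enc' (\<sigma> p)) = enc' p" using \<sigma>(1) by (simp add: \<pi>_def ed bij_is_inj)
    then have "act_pair c True False (\<sigma> p) = p"
      by (simp add: act_pair_def c_def enc'_def)
    then show ?thesis by (simp add: \<sigma>(2) act_type_type_of[OF c] act_mat k)
  qed
  have sym: "act_type c (\<phi> (type_of (g2 b b (x, x)))) = type_of (g2 b b (x, x))" for b x
  proof -
    have "act_pair c b b (x \<noteq> e b, x \<noteq> e b) = (x, x)"
      by (cases b; cases "e b"; simp add: act_pair_def c_def)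
    then show ?thesis by (simp add: e act_type_type_of[OF c] act_mat k)
  qed
  have single: "act_type c (\<phi> (type_of (g2 b b (True, False)))) = type_of (g2 b b (True, False))" for b
  proof -
    have "act_pair c b b (True, False) = (True, False)"
      by (cases b; simp add: act_pair_def c_def)
    then show ?thesis by (simp add: image_single act_type_type_of[OF c] act_mat k)
  qed
  have "act_type c (\<phi> (type_of (g2 a b p))) = type_of (g2 a b p)" for a b p
  proof -
    consider "a" "\<not> b" | "\<not> a" b | "a = b" "fst p = snd p" | "a = b" "p = (True, False)"
      | "a = b" "p = (False, True)" by (cases p) auto
    then show ?thesis
    proof cases
      case 1 then show ?thesis using loop by simp
    next
      case 2
      then have "type_of (g2 a b p) = type_of (g2 True False (prod.swap p))" by (simp add: type_of_g2_eq)
      then show ?thesis using loop by simp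
    next
      case 3 then show ?thesis using sym[of b "snd p"] by (cases p) simp
    next
      case 4 then show ?thesis using single by simp
    next
      case 5
      then have "type_of (g2 a b p) = type_of (g2 b b (True, False))" by (simp add: type_of_g2_eq)
      then show ?thesis using single by simp
    qed
  qed
  then have "level4_aut2 (act_type c \<circ> \<phi>)"
    using level4_aut_act[OF c level4_aut_axioms] g1
    by (simp add: level4_aut2_def level4_aut1_def level4_aut1_axioms_def level4_aut2_axioms_def)
  then show ?thesis using c by blast
qed

section \<open>Three vertices\<close>

definition flip :: "bool \<Rightarrow> bool \<times> bool \<Rightarrow> bool \<times> bool" where
  "flip e p = (if e then prod.swap p else p)"

text \<open>The tournament is cyclic iff \<open>x = y\<close> and \<open>y\<close> differs from
  \<open>z\<close>, where \<open>z\<close> belongs to the pair 02. Relabelling identifies the two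
  cyclic orientations, and also the six others.\<close>

lemma type_of_tournament_eq:
  "type_of (g3 b b b (x, \<not> x) (y, \<not> y) (z, \<not> z)) = type_of (g3 b b b (x', \<not> x') (y', \<not> y') (z', \<not> z'))
    \<longleftrightarrow> (x = y \<and> y \<noteq> z) = (x' = y' \<and> y' \<noteq> z')"
proof -
  define f where "f x y z = type_of (g3 b b b (x, \<not> x) (y, \<not> y) (z, \<not> z))" for x y z
  \<comment> \<open>The vertices are listed in the order 1, 2, 0 here and in the order 1, 0, 2 for
    \<open>refl\<close>.\<close>
  have rot: "f x y z = f y (\<not> z) (\<not> x)" for x y z
    using type_of_g3I[of "g3 b b b (x, \<not> x) (y, \<not> y) (z, \<not> z)" "Suc 0" 2 0]
    by (simp add: f_def g_simps)
  have refl: "f x y z = f (\<not> x) z y" for x y z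
    using type_of_g3I[of "g3 b b b (x, \<not> x) (y, \<not> y) (z, \<not> z)" "Suc 0" 0 2]
    by (simp add: f_def g_simps)
  have "f True False False = f True True True" "f False True False = f True True True"
    "f False True True = f True True True" "f False False False = f True True True"
    "f True False True = f True True True" "f False False True = f True True False"
    using rot[of True True True] rot[of True False False] refl[of True True True]
      refl[of True False False] refl[of False True False] refl[of False False True] by simp_all
  then have canon: "f x y z = (if x = y \<and> y \<noteq> z then f True True False else f True True True)" for x y z
    by (cases x; cases y; cases z; simp)
  have "\<not> embeds (g3 b b b (True, False) (True, False) (False, True))
      (g3 b b b (True, False) (True, False) (True, False))"
    by (auto simp: embeds_g3 g_simps)
  then have "f True True False \<noteq> f True True True" by (simp add: f_def type_of_eq_iff)
  then show ?thesis
    unfolding f_def[symmetric] canon[of x y z] canon[of x' y' z'] by simp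
qed

context level4_aut2
begin

lemma embeds_g2_image:
  assumes "G \<in> fin_digraphs" "size_of G \<le> 4" "H \<in> fin_digraphs" "\<phi> (type_of G) = type_of H"
  shows "embeds (g2 a b p) H \<longleftrightarrow> embeds (g2 a b p) G"
  using embeds_image[OF _ _ assms(1,2) _ assms(3) fix2 assms(4)] by simp

text \<open>As the two-vertex types are fixed, image and original have the same pairs below them.
  This determines the two labels at the vertex whose loop differs and the pair \<open>p\<close>
  between the others, but not which end of \<open>p\<close> belongs to which label.\<close>

lemma image_mixed:
  "\<exists>p'. (p' = p \<or> p' = prod.swap p) \<and>
     \<phi> (type_of (g3 (\<not> b) b b l p m)) = type_of (g3 (\<not> b) b b l p' m)"
proof -
  let ?G = "g3 (\<not> b) b b l p m"
  obtain H where H: "H \<in> fin_digraphs" "size_of H = 3" "\<phi> (type_of ?G) = type_of H"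
    using image_type[of ?G] by auto
  note emb = embeds_g2_image[of ?G H, OF _ _ H(1,3), simplified]
  obtain u v where uv: "u \<in> pverts H" "v \<in> pverts H" "u \<noteq> v"
      "looped H u = b" "looped H v = b" "arcs_of H u v = p"
    using emb[of b b p] by (auto simp: embeds_g2 g_simps)
  obtain w where w: "w \<in> pverts H" "looped H w = (\<not> b)"
    using loops_image[of ?G H "\<not> b"] H by (auto simp: g_simps)
  have ne: "w \<noteq> u" "w \<noteq> v" using w uv by auto
  have "{w, u, v} = pverts H"
    using H uv w ne by (intro card_subset_eq) (auto simp: fin_digraphs_iff size_of_def)
  then have V: "x \<in> pverts H \<Longrightarrow> x = w \<or> x = u \<or> x = v" for x by blast
  have sub: "arcs_of H w x = l \<or> arcs_of H w x = m" if "x = u \<or> x = v" for x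
  proof -
    have "embeds (g2 (\<not> b) b (arcs_of H w x)) H"
      using that uv w ne by (auto simp: embeds_g2)
    then show ?thesis using emb by (auto simp: embeds_g2 g_simps)
  qed
  have sup: "arcs_of H w u = k \<or> arcs_of H w v = k" if "k = l \<or> k = m" for k
  proof -
    have "embeds (g2 (\<not> b) b k) H"
      using that emb by (auto simp: embeds_g2 g_simps)
    then show ?thesis using V uv w by (auto simp: embeds_g2)
  qed
  consider "arcs_of H w u = l" "arcs_of H w v = m" | "arcs_of H w u = m" "arcs_of H w v = l"
    using sub[of u] sub[of v] sup[of l] sup[of m] by metis
  then show ?thesis
  proof cases
    case 1
    then have "\<phi> (type_of ?G) = type_of (g3 (\<not> b) b b l p m)"
      using type_of_g3I[of H w u v] H uv w ne by simp
    then show ?thesis by blast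
  next
    case 2
    moreover have "arcs_of H v u = prod.swap p" using uv arcs_of_swap[of H v u "prod.swap p"] by simp
    ultimately have "\<phi> (type_of ?G) = type_of (g3 (\<not> b) b b l (prod.swap p) m)"
      using type_of_g3I[of H w v u] H uv w ne by simp
    then show ?thesis by blast
  qed
qed

text \<open>Of interest for distinct labels; for equal labels the two single arcs give the same
  type.\<close>

definition flips :: "bool \<Rightarrow> bool \<times> bool \<Rightarrow> bool \<times> bool \<Rightarrow> bool" where
  "flips b l m \<longleftrightarrow> \<phi> (type_of (g3 (\<not> b) b b l (True, False) m)) = type_of (g3 (\<not> b) b b l (False, True) m)"

text \<open>One orientation decides: by injectivity the opposite arc is reversed together with it,
  and reversal leaves symmetric pairs unchanged.\<close>

lemma image_mixed_flips:
  assumes "l \<noteq> m"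
  shows "\<phi> (type_of (g3 (\<not> b) b b l p m)) = type_of (g3 (\<not> b) b b l (flip (flips b l m) p) m)"
proof -
  have eq: "type_of (g3 (\<not> b) b b l p m) = type_of (g3 (\<not> b) b b l q m) \<longleftrightarrow> p = q" for p q
    using assms by (auto simp: type_of_mixed_eq)
  let ?M = "\<lambda>p. type_of (g3 (\<not> b) b b l p m)"
  have tf: "\<phi> (?M (True, False)) = ?M (if flips b l m then (False, True) else (True, False))"
  proof -
    obtain p' where p': "p' = (True, False) \<or> p' = (False, True)" "\<phi> (?M (True, False)) = ?M p'"
      using image_mixed[of "(True, False)" b l m] unfolding swap_simp by blast
    show ?thesis
    proof (cases "flips b l m")
      case True
      then show ?thesis by (simp add: flips_def)
    next
      case False
      then have "p' \<noteq> (False, True)" using p'(2) unfolding flips_def by blast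
      then show ?thesis using p' False by simp
    qed
  qed
  have ft: "\<phi> (?M (False, True)) = ?M (if flips b l m then (True, False) else (False, True))"
  proof -
    obtain p' where p': "p' = (True, False) \<or> p' = (False, True)" "\<phi> (?M (False, True)) = ?M p'"
      using image_mixed[of "(False, True)" b l m] unfolding swap_simp by blast
    have "\<phi> (?M (True, False)) \<noteq> \<phi> (?M (False, True))"
      by (simp add: inj_type eq)
    then show ?thesis using p' unfolding tf p'(2) by (auto split: if_splits)
  qed
  have sym: "\<phi> (?M (x, x)) = ?M (x, x)" for x
    using image_mixed[of "(x, x)" b l m] by auto
  consider x where "p = (x, x)" | "p = (True, False)" | "p = (False, True)"
    by (cases p) auto
  then show ?thesis
    by cases (simp_all add: flip_def tf ft sym)
qed

text \<open>The vertex \<open>0\<close> of \<open>g4\<close> sees the other three with distinct labels, which rigidifies them.\<close>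

lemma image_mono:
  assumes dist: "l \<noteq> m" "m \<noteq> n" "l \<noteq> n"
  shows "\<phi> (type_of (g3 b b b p q s)) =
    type_of (g3 b b b (flip (flips b l m) p) (flip (flips b m n) q) (flip (flips b l n) s))"
proof -
  let ?G = "g4 b l m n p q s" and ?K = "g3 b b b p q s"
  obtain H where H: "H \<in> fin_digraphs" "size_of H = 4" "\<phi> (type_of ?G) = type_of H"
    using image_type[of ?G] by auto
  obtain K where K: "K \<in> fin_digraphs" "size_of K = 3" "\<phi> (type_of ?K) = type_of K"
    using image_type[of ?K] by auto
  have loopK: "looped K x = b" if "x \<in> pverts K" for x
    using loops_image[of ?K K "\<not> b"] K that by (auto simp: g_simps)
  have "embeds ?K ?G" by (auto simp: embeds_g3 g_simps)
  then have "embeds K H" using embeds_image[of ?K ?G K H] H K by simp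
  then obtain f where f: "is_emb f K H" by (auto simp: embeds_def)
  define U where "U = f ` pverts K"
  have U: "U \<subseteq> pverts H" "card U = 3" "finite U"
    using f K by (auto simp: is_emb_def size_of_def U_def card_image fin_digraphs_iff)
  have loopU: "looped H x = b" if "x \<in> U" for x
    using that f loopK by (auto simp: U_def is_emb_def looped_def)
  \<comment> \<open>Each three-vertex digraph with distinct labels below \<open>?G\<close> reappears
    below \<open>H\<close>, its arc reversed as \<open>flips\<close> prescribes.\<close>
  have mixed: "\<exists>w\<in>pverts H. \<exists>u\<in>pverts H. \<exists>v\<in>pverts H. u \<noteq> v \<and> looped H w = (\<not> b) \<and>
      looped H u = b \<and> looped H v = b \<and> arcs_of H w u = i \<and> arcs_of H w v = j \<and>
      arcs_of H u v = flip (flips b i j) r"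
    if "i \<noteq> j" "embeds (g3 (\<not> b) b b i r j) ?G" for i j r
  proof -
    have "embeds (g3 (\<not> b) b b i (flip (flips b i j) r) j) H"
      using embeds_image[OF _ _ _ _ _ _ image_mixed_flips[OF that(1)] H(3)] H that(2) by simp
    then show ?thesis unfolding embeds_g3 by blast
  qed
  obtain w u v where 1: "w \<in> pverts H" "u \<in> pverts H" "v \<in> pverts H" "u \<noteq> v" "looped H w = (\<not> b)"
      "looped H u = b" "looped H v = b" "arcs_of H w u = l" "arcs_of H w v = m"
      "arcs_of H u v = flip (flips b l m) p"
    using mixed[OF dist(1), of p] by (auto simp: embeds_g3 g_simps)
  obtain w2 v2 t where 2: "w2 \<in> pverts H" "v2 \<in> pverts H" "t \<in> pverts H" "v2 \<noteq> t" "looped H w2 = (\<not> b)"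
      "looped H v2 = b" "looped H t = b" "arcs_of H w2 v2 = m" "arcs_of H w2 t = n"
      "arcs_of H v2 t = flip (flips b m n) q"
    using mixed[OF dist(2), of q] by (auto simp: embeds_g3 g_simps)
  obtain w3 u3 t3 where 3: "w3 \<in> pverts H" "u3 \<in> pverts H" "t3 \<in> pverts H" "u3 \<noteq> t3" "looped H w3 = (\<not> b)"
      "looped H u3 = b" "looped H t3 = b" "arcs_of H w3 u3 = l" "arcs_of H w3 t3 = n"
      "arcs_of H u3 t3 = flip (flips b l n) s"
    using mixed[OF dist(3), of s] by (auto simp: embeds_g3 g_simps)
  \<comment> \<open>\<open>U\<close> supplies three vertices with loop mark \<open>b\<close>, so
    \<open>w\<close> is the only other vertex of \<open>H\<close> and the three configurations share
    it.\<close>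
  have "w \<notin> U" using loopU 1 by auto
  then have "insert w U = pverts H"
    using U 1 H by (intro card_subset_eq) (auto simp: fin_digraphs_iff size_of_def)
  then have V: "x = w \<or> x \<in> U" if "x \<in> pverts H" for x using that by blast
  have "w2 = w" "w3 = w" using V[OF 2(1)] V[OF 3(1)] loopU 2(5) 3(5) by auto
  note lab = 1(8,9) 2(8,9)[unfolded this] 3(8,9)[unfolded this]
  have uvt: "u \<in> U" "v \<in> U" "t \<in> U" using V 1 2 by auto
  have ne: "u \<noteq> v" "v \<noteq> t" "u \<noteq> t" using lab dist by auto
  have "{u, v, t} = U"
    using U uvt ne by (intro card_subset_eq) auto
  \<comment> \<open>Since the labels at \<open>w\<close> are distinct, equal labels identify the
    vertices of the three configurations.\<close>
  then have "x = u \<or> x = v \<or> x = t" if "looped H x = b" "x \<in> pverts H" for x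
    using that V 1 by blast
  then have "v2 = v" "u3 = u" "t3 = t"
    using lab dist 2(2,6) 3(2,3,6,7) by metis+
  note arcs = 1(10) 2(10)[unfolded this] 3(10)[unfolded this]
  obtain x y z where xyz: "x \<in> pverts K" "y \<in> pverts K" "z \<in> pverts K" "u = f x" "v = f y" "t = f z"
    using uvt by (auto simp: U_def)
  have "arcs_of K i j = arcs_of H (f i) (f j)" if "i \<in> pverts K" "j \<in> pverts K" for i j
    using that f by (simp add: is_emb_def arcs_of_def)
  then have "arcs_of K x y = flip (flips b l m) p" "arcs_of K y z = flip (flips b m n) q"
     "arcs_of K x z = flip (flips b l n) s"
    using arcs xyz by auto
  moreover have "x \<noteq> y" "y \<noteq> z" "x \<noteq> z" using ne xyz by auto
  ultimately show ?thesis
    using type_of_g3I[OF K(1,2) xyz(1,2,3)] K(3) loopK xyz(1,2,3) by simp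
qed

text \<open>Reversing one or two arcs of a cyclic tournament makes it transitive, and so does reversing
  the same arcs of some transitive one.\<close>

lemma flips_triple:
  assumes dist: "l \<noteq> m" "m \<noteq> n" "l \<noteq> n"
  shows "flips b l m = flips b m n \<and> flips b l n = flips b m n"
proof -
  define e1 e2 e3 where e: "e1 = flips b l m" "e2 = flips b m n" "e3 = flips b l n"
  have flip: "flip e (x, \<not> x) = (x \<noteq> e, \<not> (x \<noteq> e))" for e x by (auto simp: flip_def)
  have "((x \<noteq> e1) = (y \<noteq> e2) \<and> (y \<noteq> e2) \<noteq> (z \<noteq> e3)) = ((x' \<noteq> e1) = (y' \<noteq> e2) \<and> (y' \<noteq> e2) \<noteq> (z' \<noteq> e3))
    \<longleftrightarrow> (x = y \<and> y \<noteq> z) = (x' = y' \<and> y' \<noteq> z')" for x y z x' y' z'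
    using inj_type[of "g3 b b b (x, \<not> x) (y, \<not> y) (z, \<not> z)" "g3 b b b (x', \<not> x') (y', \<not> y') (z', \<not> z')"]
    unfolding image_mono[OF dist] flip e[symmetric] type_of_tournament_eq by simp
  \<comment> \<open>The cyclic tournament \<open>True True False\<close> is compared with the other
    seven orientations, of which the last listed is again cyclic.\<close>
  from this[of True True False True True True] this[of True True False False True True]
    this[of True True False True False True] this[of True True False True False False]
    this[of True True False False True False] this[of True True False False False False]
    this[of True True False False False True]
  have "e1 = e2 \<and> e3 = e2" by (cases e1; cases e2; cases e3; simp)
  then show ?thesis by (simp add: e)
qed

text \<open>\<open>flips_triple\<close> links label pairs inside a triangle, and through triangles
  each pair of distinct labels reaches the reference pair \<open>(False, False)\<close>,
  \<open>(True, True)\<close>.\<close>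

lemma flips_const: "\<exists>\<rho>. \<forall>l m. l \<noteq> m \<longrightarrow> flips b l m = \<rho>"
proof -
  have left: "flips b l n = flips b m n" if "l \<noteq> n" "m \<noteq> n" for l m n
    using that flips_triple[of l m n b] by (cases "l = m") auto
  have "flips b l m = flips b (False, False) (True, True)" if "l \<noteq> m" for l m
  proof (cases "m = (True, True)")
    case True
    then show ?thesis using that left[of l m "(False, False)"] by simp
  next
    case False
    \<comment> \<open>A label that completes \<open>m\<close> and \<open>(True, True)\<close> to a
      triangle.\<close>
    define k where "k = (if m = (False, False) then (True, False) else (False, False))"
    have k: "k \<noteq> m" "k \<noteq> (True, True)" by (auto simp: k_def)
    have "flips b l m = flips b k m" using that k by (intro left) auto
    also have "\<dots> = flips b m (True, True)" using k False flips_triple[of k m "(True, True)" b] by simp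
    also have "\<dots> = flips b (False, False) (True, True)" using False by (intro left) auto
    finally show ?thesis .
  qed
  then show ?thesis by blast
qed

text \<open>What is left of \<phi> is one bit of reversal for each loop mark, and these bits are the
  third and fourth entries of the group element.\<close>

lemma agrees: "agrees_with_C \<phi>"
proof -
  obtain \<rho> where \<rho>: "\<And>b l m. l \<noteq> m \<Longrightarrow> flips b l m = \<rho> b" using flips_const by metis
  define c :: "base_elem \<times> int" where
    "c = ((0, 0, if \<rho> False then 1 else 0, if \<rho> True then 1 else 0, id), 0)"
  have c: "c \<in> carrier C_group" by (simp add: c_def carrier_C_group carrier_base_group)
  have k: "snd c \<noteq> 1" by (simp add: c_def)
  have pair_mono: "act_pair c a a p = flip (\<rho> a) p" for a p
    by (cases p; cases a) (auto simp: act_pair_def c_def flip_def)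
  have pair_mixed: "act_pair c a a' p = p" if "a \<noteq> a'" for a a' p
    using that by (cases a; cases a') (auto simp: act_pair_def c_def)
  have "\<phi> X = act_type c X" if X: "X \<in> levels 3" for X
  proof -
    obtain G where G: "G \<in> fin_digraphs" "size_of G \<le> 3" "X = type_of G"
      using X by (auto simp: first_levels_iso_types)
    then consider "size_of G = 1" | "size_of G = 2" | "size_of G = 3"
      using size_of_pos[of G] by linarith
    then show ?thesis
    proof cases
      case 1
      then obtain a where "X = type_of (g1 a)" using G exhaust_size1 by metis
      then show ?thesis using k by (simp add: fix1 act_type_type_of[OF c] act_mat)
    next
      case 2
      then obtain a a' p where X: "X = type_of (g2 a a' p)" using G exhaust_size2 by metis
      then have "act_type c X = type_of (g2 a a' (act_pair c a a' p))"
        using k by (simp add: act_type_type_of[OF c] act_mat)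
      \<comment> \<open>Reversing the arc between two like vertices does not change the
        type.\<close>
      also have "\<dots> = X"
        using X by (cases "a = a'") (auto simp: pair_mono pair_mixed flip_def type_of_g2_eq)
      finally show ?thesis using X fix2 by simp
    next
      case 3
      from G(1) 3 show ?thesis
      proof (cases rule: exhaust_size3)
        case (mono b p q s)
        \<comment> \<open>Any three distinct labels serve here.\<close>
        then show ?thesis
          using image_mono[of "(False, False)" "(True, False)" "(False, True)" b p q s] k G(3)
          by (simp add: \<rho> act_type_type_of[OF c] act_mat pair_mono)
      next
        case (mixed b l p m)
        then have X: "act_type c X = type_of (g3 (\<not> b) b b l (flip (\<rho> b) p) m)"
          using k G(3) by (simp add: act_type_type_of[OF c] act_mat pair_mono pair_mixed)
        show ?thesis
        proof (cases "l = m")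
          case True
          \<comment> \<open>Exchanging the two vertices with equal labels reverses the arc, so both
            images left open by \<open>image_mixed\<close> are the same type.\<close>
          have "type_of (g3 (\<not> b) b b l (prod.swap p) m) = type_of (g3 (\<not> b) b b l p m)"
            unfolding True by (subst type_of_mixed_eq) simp
          then show ?thesis
            using image_mixed[of p b l m] X G(3) mixed by (cases "\<rho> b") (auto simp: flip_def)
        next
          case False
          then show ?thesis using image_mixed_flips[OF False, of b p] X G(3) mixed by (simp add: \<rho>)
        qed
      qed
    qed
  qed
  then show ?thesis using c by (auto simp: agrees_with_C_def)
qed

end

lemma level4_aut_agrees:
  assumes "is_aut (levels 4) \<phi>"
  shows "\<exists>c\<in>carrier C_group. \<forall>X\<in>levels 3. \<phi> X = act_type c X"
proof -
  have \<phi>: "level4_aut \<phi>" using assms by (rule level4_aut.intro)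
  obtain c where c: "c \<in> carrier C_group" "level4_aut1 (act_type c \<circ> \<phi>)"
    using normalize_vertices[OF \<phi>] by blast
  obtain d where d: "d \<in> carrier C_group" "level4_aut2 (act_type d \<circ> (act_type c \<circ> \<phi>))"
    using normalize_pairs[OF c(2)] by blast
  have "agrees_with_C (act_type d \<circ> (act_type c \<circ> \<phi>))" using d(2) by (rule level4_aut2.agrees)
  then have "agrees_with_C (act_type c \<circ> \<phi>)"
    using agrees_with_C_act d(1) level4_aut_act[OF c(1) \<phi>] by blast
  then show ?thesis using agrees_with_C_act[OF c(1) \<phi>] by (simp add: agrees_with_C_def)
qed

section \<open>The group of restrictions\<close>

lemma is_aut_restrict: "is_aut P (restrict \<phi> P) \<longleftrightarrow> is_aut P \<phi>"
  by (simp add: is_aut_def)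

lemma restrict_in_order_auts: "is_aut P \<phi> \<Longrightarrow> restrict \<phi> P \<in> order_auts P (\<sqsubseteq>\<^sub>D)"
  by (simp add: order_auts_iff is_aut_restrict)

lemma group_OrderAutGroup: "group (OrderAutGroup P (\<sqsubseteq>\<^sub>D))"
proof -
  have "subgroup (order_auts P (\<sqsubseteq>\<^sub>D)) (BijGroup P)"
  proof (rule subgroup.intro)
    show sub: "order_auts P (\<sqsubseteq>\<^sub>D) \<subseteq> carrier (BijGroup P)"
      by (auto simp: order_auts_def BijGroup_def)
    fix x assume x: "x \<in> order_auts P (\<sqsubseteq>\<^sub>D)"
    have xB: "x \<in> Bij P" using x by (simp add: order_auts_def)
    show "inv\<^bsub>BijGroup P\<^esub> x \<in> order_auts P (\<sqsubseteq>\<^sub>D)"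
      using x is_aut_inv[of P x] restrict_in_order_auts inv_BijGroup[OF xB] by (simp add: order_auts_iff)
    fix y assume y: "y \<in> order_auts P (\<sqsubseteq>\<^sub>D)"
    then have yB: "y \<in> Bij P" by (simp add: order_auts_def)
    have "compose P x y = restrict (x \<circ> y) P" by (rule ext) (simp add: compose_def)
    then show "x \<otimes>\<^bsub>BijGroup P\<^esub> y \<in> order_auts P (\<sqsubseteq>\<^sub>D)"
      using x y xB yB is_aut_comp restrict_in_order_auts by (simp add: BijGroup_def order_auts_iff)
  next
    have "is_aut P (\<lambda>X. X)" by (simp add: is_aut_def bij_betw_def)
    then show "\<one>\<^bsub>BijGroup P\<^esub> \<in> order_auts P (\<sqsubseteq>\<^sub>D)"
      using restrict_in_order_auts by (simp add: BijGroup_def)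
  qed
  then show ?thesis
    using subgroup.subgroup_is_group[OF _ group_BijGroup] by (simp add: OrderAutGroup_def)
qed

section \<open>Restrictions of the action to the first three levels\<close>

definition restr_act :: "base_elem \<times> int \<Rightarrow> iso_type \<Rightarrow> iso_type" where
  "restr_act c = restrict (act_type c) (levels 3)"

lemma levels_mono: "m \<le> n \<Longrightarrow> levels m \<subseteq> levels n"
  by (auto simp: first_levels_iso_types)

text \<open>The first of three inclusions that close a cycle through the image of
  \<open>restr_act\<close> and so force equality.\<close>

lemma restricted_auts_iso_types_subset:
  "restricted_auts 3 iso_types \<subseteq> restricted_auts 3 (levels 4)"
proof
  fix f assume "f \<in> restricted_auts 3 iso_types"
  then obtain \<phi> where \<phi>: "is_aut iso_types \<phi>" "f = restrict \<phi> (levels 3)"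
    by (auto simp: restricted_auts_def order_auts_iff)
  have "restrict \<phi> (levels 4) \<in> order_auts (levels 4) (\<sqsubseteq>\<^sub>D)"
    by (rule restrict_in_order_auts[OF is_aut_first_levels[OF down_closed_iso_types \<phi>(1)]])
  moreover have "f = restrict (restrict \<phi> (levels 4)) (levels 3)"
    using levels_mono[of 3 4] by (simp add: \<phi> restrict_restrict Int_absorb1)
  moreover have "first_levels 3 (levels 4) = levels 3" by (simp add: first_levels_first_levels)
  ultimately show "f \<in> restricted_auts 3 (levels 4)"
    unfolding restricted_auts_def
    by (metis (no_types, lifting) image_eqI)
qed

lemma restricted_auts_levels_subset:
  "restricted_auts 3 (levels 4) \<subseteq> restr_act ` carrier C_group"
proof
  fix f assume "f \<in> restricted_auts 3 (levels 4)"
  then obtain \<phi> where \<phi>: "is_aut (levels 4) \<phi>" "f = restrict \<phi> (levels 3)"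
    by (auto simp: restricted_auts_def order_auts_iff first_levels_first_levels)
  then obtain c where "c \<in> carrier C_group" "\<forall>X\<in>levels 3. \<phi> X = act_type c X"
    using level4_aut_agrees by blast
  then show "f \<in> restr_act ` carrier C_group"
    using \<phi>(2) restrict_ext[of "levels 3" \<phi> "act_type c"] by (auto simp: restr_act_def)
qed

text \<open>The action is defined on all isomorphism types, so its restriction to three levels comes
  from an automorphism of the whole poset.\<close>

lemma restr_act_in_restricted_auts:
  "restr_act ` carrier C_group \<subseteq> restricted_auts 3 iso_types"
proof
  fix f assume "f \<in> restr_act ` carrier C_group"
  then obtain c where c: "c \<in> carrier C_group" "f = restr_act c" by blast
  have "restrict (act_type c) iso_types \<in> order_auts iso_types (\<sqsubseteq>\<^sub>D)"
    by (rule restrict_in_order_auts[OF is_aut_act_type(1)[OF c(1)]])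
  moreover have "f = restrict (restrict (act_type c) iso_types) (levels 3)"
    by (auto simp: c restr_act_def first_levels_def)
  ultimately show "f \<in> restricted_auts 3 iso_types" 
    unfolding restricted_auts_def by (rule image_eqI[rotated, where f = "\<lambda>\<phi>. restrict \<phi> (levels 3)"])
qed

lemma restr_act_hom: "restr_act \<in> hom C_group (OrderAutGroup (levels 3) (\<sqsubseteq>\<^sub>D))"
proof (rule homI)
  have in_auts: "restr_act c \<in> order_auts (levels 3) (\<sqsubseteq>\<^sub>D)" if "c \<in> carrier C_group" for c
    unfolding restr_act_def by (rule restrict_in_order_auts[OF is_aut_act_type(2)[OF that]])
  show "restr_act c \<in> carrier (OrderAutGroup (levels 3) (\<sqsubseteq>\<^sub>D))" if "c \<in> carrier C_group" for c
    using in_auts[OF that] by (simp add: OrderAutGroup_def)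
  fix c d assume c: "c \<in> carrier C_group" and d: "d \<in> carrier C_group"
  have "restr_act (c \<otimes>\<^bsub>C_group\<^esub> d) X = compose (levels 3) (restr_act c) (restr_act d) X" for X
    using act_type_mult[OF c d, of X] act_type_first_levels[OF d, of X 3]
    by (auto simp: restr_act_def compose_def first_levels_def)
  moreover have "restr_act c \<in> Bij (levels 3)" "restr_act d \<in> Bij (levels 3)"
    using in_auts c d by (simp_all add: order_auts_def)
  ultimately show "restr_act (c \<otimes>\<^bsub>C_group\<^esub> d) =
      restr_act c \<otimes>\<^bsub>OrderAutGroup (levels 3) (\<sqsubseteq>\<^sub>D)\<^esub> restr_act d"
    by (simp add: OrderAutGroup_def BijGroup_def fun_eq_iff)
qed

text \<open>Small digraphs detect the entries one by one: a single vertex shows \<open>k\<close>,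
  empty pairs show \<open>p\<close> and \<open>q\<close>, mixed pairs show \<pi>. For
  \<open>r\<close> and \<open>s\<close> three vertices are taken, where a vertex of opposite loop
  with distinct labels makes the orientation of an arc visible.\<close>

lemma act_type_trivial:
  assumes c: "c \<in> carrier C_group" and fix3: "\<And>X. X \<in> levels 3 \<Longrightarrow> act_type c X = X"
  shows "c = \<one>\<^bsub>C_group\<^esub>"
proof -
  obtain p q r s \<pi> k where c': "c = ((p, q, r, s, \<pi>), k)" by (metis prod.exhaust)
  have rng: "p = 0 \<or> p = 1" "q = 0 \<or> q = 1" "r = 0 \<or> r = 1" "s = 0 \<or> s = 1" "k = 0 \<or> k = 1"
    using c by (auto simp: c' carrier_C_group carrier_base_group)
  have *: "type_of (act c G) = type_of G" if "G \<in> fin_digraphs" "size_of G \<le> 3" for G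
    using fix3[of "type_of G"] that c by (simp add: act_type_type_of)
  have k: "k = 0" using *[of "g1 False"] rng(5) by (auto simp: act_mat c')
  have p: "p = 0" using *[of "g2 False False (False, False)"] k rng(1)
    by (auto simp: act_mat c' act_pair_def type_of_g2_eq)
  have q: "q = 0" using *[of "g2 True True (False, False)"] k rng(2)
    by (auto simp: act_mat c' act_pair_def type_of_g2_eq)
  have "\<pi> (enc a b) = enc a b" for a b
  proof -
    have "dec1 (\<pi> (enc a b)) = a" "dec2 (\<pi> (enc a b)) = b"
      using *[of "g2 True False (a, b)"] k by (simp_all add: act_mat c' act_pair_def type_of_g2_eq)
    then show ?thesis using enc_dec(1)[of "\<pi> (enc a b)"] by simp
  qed
  then have "\<pi> l = l" for l using enc_dec(1)[of l] by metis
  then have \<pi>: "\<pi> = id" by (simp add: fun_eq_iff)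
  have r: "r = 0"
    using *[of "g3 (\<not> False) False False (False, False) (True, False) (True, True)"] k rng(3)
    unfolding act_mat by (auto simp: c' \<pi> act_pair_def dec1_def dec2_def type_of_mixed_eq[of False, simplified])
  have s: "s = 0"
    using *[of "g3 (\<not> True) True True (False, False) (True, False) (True, True)"] k rng(4)
    unfolding act_mat by (auto simp: c' \<pi> act_pair_def dec1_def dec2_def type_of_mixed_eq[of True, simplified])
  show ?thesis by (simp add: c' one_C_group p q r s \<pi> k)
qed

lemma card_bij_letter: "card {\<pi> :: letter \<Rightarrow> letter. bij \<pi>} = 24"
proof -
  have U: "(UNIV :: letter set) = {LA, LB, LC, LD}" by (auto intro: letter.exhaust)
  have "finite (UNIV :: letter set)" "card (UNIV :: letter set) = 4" unfolding U by simp_all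
  then have "card {\<pi>. \<pi> permutes (UNIV :: letter set)} = fact 4" by (intro card_permutations)
  moreover have "\<pi> permutes (UNIV :: letter set) \<longleftrightarrow> bij \<pi>" for \<pi>
    by (auto simp: permutes_def bij_iff)
  ultimately show ?thesis by (simp add: fact_numeral)
qed

theorem theorem1p2:
  shows "restricted_auts 3 iso_types = restricted_auts 3 (first_levels 4 iso_types)
    \<and> subgroup (restricted_auts 3 iso_types)
        (OrderAutGroup (first_levels 3 iso_types) (\<sqsubseteq>\<^sub>D))
    \<and> (OrderAutGroup (first_levels 3 iso_types) (\<sqsubseteq>\<^sub>D))
          \<lparr>carrier := restricted_auts 3 iso_types\<rparr> \<cong> C_group
    \<and> order C_group = 768"
proof (intro conjI)
  let ?A = "OrderAutGroup (levels 3) (\<sqsubseteq>\<^sub>D)"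
  have image: "restr_act ` carrier C_group = restricted_auts 3 iso_types"
    using restricted_auts_iso_types_subset restricted_auts_levels_subset restr_act_in_restricted_auts
    by blast
  show "restricted_auts 3 iso_types = restricted_auts 3 (levels 4)"
    using restricted_auts_iso_types_subset restricted_auts_levels_subset image by blast
  interpret h: group_hom C_group ?A restr_act
    by (intro group_hom.intro group_hom_axioms.intro group_C_group group_OrderAutGroup restr_act_hom)
  show "subgroup (restricted_auts 3 iso_types) ?A"
    using h.img_is_subgroup by (simp add: image)
  have "c = \<one>\<^bsub>C_group\<^esub>" if "c \<in> carrier C_group" "restr_act c = \<one>\<^bsub>?A\<^esub>" for c
  proof (rule act_type_trivial[OF that(1)])
    fix X assume "X \<in> levels 3"
    then show "act_type c X = X"
      using fun_cong[OF that(2), of X] by (simp add: restr_act_def OrderAutGroup_def BijGroup_def)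
  qed
  then have "inj_on restr_act (carrier C_group)" using h.inj_on_one_iff by blast
  then have "restr_act \<in> iso C_group (?A \<lparr>carrier := restricted_auts 3 iso_types\<rparr>)"
    using restr_act_hom image by (auto simp: iso_def hom_def bij_betw_def)
  then show "?A \<lparr>carrier := restricted_auts 3 iso_types\<rparr> \<cong> C_group"
    using group.iso_sym[OF group_C_group] by (auto simp: is_iso_def)
  \<comment> \<open>Five factors of order 2 and 24 bijections of the letters.\<close>
  show "order C_group = 768"
    by (simp add: order_def carrier_C_group carrier_base_group card_cartesian_product card_bij_letter)
qed

end
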